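(* Let $\mathcal{L} := [0,\infty)^d \setminus [0,1]^d$. For $\mu \in \mathbb{R}^d$ and $\Theta \in \mathcal{S}_{\mathbf 1}^{d\times d}$ (the real symmetric $d \times d$ matrices with $\Theta\mathbf{1} = 0$), let $$f^{\rm gen HR}_{\mu,\Theta}(\mathbf{y}) := \frac{1}{Z(\mu,\Theta)} \exp\Big\{ -\mu^\top(\log\mathbf{y}) - (\log\mathbf{y})^\top \Theta (\log\mathbf{y}) \Big\}, \quad \mathbf{y} \in \mathcal{L}.$$ Let $\mathcal{S}_{\mathbf 1,+}^{d\times d}$ be the set of matrices in $\mathcal{S}_{\mathbf 1}^{d\times d}$ that are positive semi-definite with rank $d-1$. Then: (i) If $\Theta \in \mathcal{S}_{\mathbf 1,+}^{d\times d}$ and $\mu = \mu_{\rm HR}(\Theta)$, then $f^{\rm gen HR}_{\mu,\Theta}$ is the density of a H\"usler--Reiss distribution. (ii) If $\Theta \in \mathcal{S}_{\mathbf 1,+}^{d\times d}$, $\mu \neq \mu_{\rm HR}(\Theta)$ and $\mu^\top\mathbf{1} > d$, then $f^{\rm gen HR}_{\mu,\Theta}$ is integrable on $\mathcal{L}$ but is not the density of a multivariate Pareto distribution. (iii) If either $\Theta \notin \mathcal{S}_{\mathbf 1,+}^{d\times d}$ or $\mu^\top\mathbf{1} \le d$, then $f^{\rm gen HR}_{\mu,\Theta}$ is not integrable on $\mathcal{L}$.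
   Context: Notation. $d$ is the dimension, $\mathbf{1}$ is the vector of ones, $\log\mathbf{y} := (\log y_1,\dots,\log y_d)$. $Z(\mu,\Theta)$ is the normalizing constant (integral over $\mathcal{L}$ of the exponential) when this integral is finite, and an arbitrary positive constant, e.g. $1$, otherwise. Formulas involving $\log\mathbf{y}$ are understood for $\mathbf{y}\in\mathcal{L}$ with all coordinates positive (the remaining points form a Lebesgue null set), and densities are set to zero outside $\mathcal{L}$ and identified up to Lebesgue null sets. Multivariate Pareto distributions. An absolutely continuous random vector $\mathbf{Y} = (Y_1,\dots,Y_d)$ with Lebesgue density $f$ has a multivariate Pareto distribution if: (MP1) it is supported on $\mathcal{L}$, i.e., $f(\mathbf{y}) = 0$ for $\mathbf{y} \notin \mathcal{L}$; (MP2) $f(t\mathbf{y}) = t^{-(d+1)} f(\mathbf{y})$ for $\mathbf{y} \in \mathcal{L}$ and $t \ge 1$; (MP3) the probabilities $P(Y_k > 1)$, $k \in \{1,\dots,d\}$, are equal to each other. H\"usler--Reiss distributions. For $\Theta \in \mathcal{S}_{\mathbf 1,+}^{d\times d}$, let $\Theta^+$ be its Moore--Penrose pseudoinverse, let $\mathrm{diag}(\Theta^+)$ be the column vector of diagonal entries of $\Theta^+$, let $\Gamma := \mathbf{1}\,\mathrm{diag}(\Theta^+)^\top + \mathrm{diag}(\Theta^+)\mathbf{1}^\top - 2\Theta^+$, and let $$\mu_{\rm HR}(\Theta) := \big(1 + \tfrac{1}{d}\big)\mathbf{1} + \tfrac{1}{2d}\,\Theta\Gamma\mathbf{1}.$$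 A multivariate Pareto distributed random vector has a H\"usler--Reiss distribution (with precision matrix $\Theta$) if for some $\Theta \in \mathcal{S}_{\mathbf 1,+}^{d\times d}$ its density is proportional, on $\mathcal{L}$, to $\exp\{ -\mu_{\rm HR}(\Theta)^\top (\log \mathbf{y}) - (\log \mathbf{y})^\top \Theta (\log \mathbf{y}) \}$. In particular, being the density of a H\"usler--Reiss distribution includes being the density of a multivariate Pareto distribution. *)

theory Defs
  imports "HOL-Probability.Probability"
begin

text \<open>
  Throughout, the dimension \<open>d\<close> is \<open>CARD('n)\<close>, and \<open>1 :: real ^ 'n\<close> is the all-ones vector.
\<close>

section \<open>Matrices\<close>

definition sym_kernel_one :: "(real ^ 'n ^ 'n) set" where
  "sym_kernel_one = {\<Theta>. transpose \<Theta> = \<Theta> \<and> \<Theta> *v 1 = 0}"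

definition pos_semidef :: "real ^ 'n ^ 'n \<Rightarrow> bool" where
  "pos_semidef A \<longleftrightarrow> transpose A = A \<and> (\<forall>x. 0 \<le> x \<bullet> (A *v x))"

definition sym_kernel_one_pos :: "(real ^ 'n ^ 'n) set" where
  "sym_kernel_one_pos = {\<Theta> \<in> sym_kernel_one. pos_semidef \<Theta> \<and> rank \<Theta> = CARD('n) - 1}"

definition penrose_inverse :: "real ^ 'n ^ 'm \<Rightarrow> real ^ 'm ^ 'n \<Rightarrow> bool" where
  "penrose_inverse A B \<longleftrightarrow>
     A ** B ** A = A \<and> B ** A ** B = B \<and>
     transpose (A ** B) = A ** B \<and> transpose (B ** A) = B ** A"

lemma penrose_inverse_unique:
  assumes "penrose_inverse A B" and "penrose_inverse A C"
  shows "B = C"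
proof -
  have AB: "A ** B = A ** C"
  proof -
    have "A ** B = transpose (A ** C ** (A ** B))"
      using assms unfolding penrose_inverse_def by (metis matrix_mul_assoc)
    also have "\<dots> = A ** B ** (A ** C)"
      using assms unfolding penrose_inverse_def by (metis matrix_transpose_mul)
    also have "\<dots> = A ** C"
      using assms unfolding penrose_inverse_def by (metis matrix_mul_assoc)
    finally show ?thesis .
  qed
  have BA: "B ** A = C ** A"
  proof -
    have "B ** A = transpose (B ** A ** (C ** A))"
      using assms unfolding penrose_inverse_def by (metis matrix_mul_assoc)
    also have "\<dots> = C ** A ** (B ** A)"
      using assms unfolding penrose_inverse_def by (metis matrix_transpose_mul)
    also have "\<dots> = C ** A"
      using assms unfolding penrose_inverse_def by (metis matrix_mul_assoc)
    finally show ?thesis .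
  qed
  have "B = B ** A ** B" using assms unfolding penrose_inverse_def by simp
  also have "\<dots> = C ** A ** C" using AB BA by (metis matrix_mul_assoc)
  also have "\<dots> = C" using assms unfolding penrose_inverse_def by simp
  finally show ?thesis .
qed

definition pinv :: "real ^ 'n ^ 'm \<Rightarrow> real ^ 'm ^ 'n" where
  "pinv A = (THE B. penrose_inverse A B)"

lemma pinv_eqI: "penrose_inverse A B \<Longrightarrow> pinv A = B"
  unfolding pinv_def by (blast intro: the_equality penrose_inverse_unique)

definition diag_vec :: "'a ^ 'n ^ 'n \<Rightarrow> 'a ^ 'n" where
  "diag_vec A = (\<chi> i. A $ i $ i)"

definition variogram :: "real ^ 'n ^ 'n \<Rightarrow> real ^ 'n ^ 'n" where
  "variogram \<Theta> =
     (\<chi> i j. diag_vec (pinv \<Theta>) $ j + diag_vec (pinv \<Theta>) $ i - 2 * pinv \<Theta> $ i $ j)"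

definition mu_HR :: "real ^ 'n ^ 'n \<Rightarrow> real ^ 'n" where
  "mu_HR \<Theta> =
     (1 + 1 / real CARD('n)) *\<^sub>R 1
     + (1 / (2 * real CARD('n))) *\<^sub>R ((\<Theta> ** variogram \<Theta>) *v 1)"

section \<open>Generalized Huesler--Reiss functions\<close>

definition pareto_domain :: "(real ^ 'n) set" where
  "pareto_domain = {0..} - {0..1}"

definition ln_vec :: "real ^ 'n \<Rightarrow> real ^ 'n" where
  "ln_vec y = (\<chi> i. ln (y $ i))"

text \<open>
  On the points of the domain with a zero coordinate the value below is an artefact of \<open>ln 0 = 0\<close>.
  These points form a null set, and all notions below are insensitive to null sets.
\<close>

definition gen_HR_exp :: "real ^ 'n \<Rightarrow> real ^ 'n ^ 'n \<Rightarrow> real ^ 'n \<Rightarrow> real" where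
  "gen_HR_exp \<mu> \<Theta> y = exp (- (\<mu> \<bullet> ln_vec y) - ln_vec y \<bullet> (\<Theta> *v ln_vec y))"

text \<open>
  The admissible values of \<open>Z(\<mu>, \<Theta>)\<close>: the integral if it is finite, any positive number otherwise.
\<close>

definition normalizing_const :: "real ^ 'n \<Rightarrow> real ^ 'n ^ 'n \<Rightarrow> real \<Rightarrow> bool" where
  "normalizing_const \<mu> \<Theta> Z \<longleftrightarrow>
     (if set_integrable lborel pareto_domain (gen_HR_exp \<mu> \<Theta>)
      then Z = set_lebesgue_integral lborel pareto_domain (gen_HR_exp \<mu> \<Theta>)
      else 0 < Z)"

definition gen_HR :: "real \<Rightarrow> real ^ 'n \<Rightarrow> real ^ 'n ^ 'n \<Rightarrow> real ^ 'n \<Rightarrow> real" where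
  "gen_HR Z \<mu> \<Theta> y = (if y \<in> pareto_domain then 1 / Z * gen_HR_exp \<mu> \<Theta> y else 0)"

section \<open>Multivariate Pareto and Huesler--Reiss distributions\<close>

text \<open>
  A density is only determined up to null sets; support and homogeneity are required of some
  version \<open>f\<close> of it.
\<close>

definition multivariate_pareto :: "'a measure \<Rightarrow> ('a \<Rightarrow> real ^ 'n) \<Rightarrow> bool" where
  "multivariate_pareto M Y \<longleftrightarrow>
     prob_space M \<and>
     (\<exists>f. (\<forall>y. 0 \<le> f y) \<and> distributed M lborel Y (\<lambda>y. ennreal (f y)) \<and>
        (\<forall>y. y \<notin> pareto_domain \<longrightarrow> f y = 0) \<and>
        (\<forall>y \<in> pareto_domain. \<forall>t \<ge> 1.
           f (t *\<^sub>R y) = t powr (- (real CARD('n) + 1)) * f y)) \<and>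
     (\<forall>k l. measure M {\<omega> \<in> space M. 1 < Y \<omega> $ k} = measure M {\<omega> \<in> space M. 1 < Y \<omega> $ l})"

definition husler_reiss :: "'a measure \<Rightarrow> ('a \<Rightarrow> real ^ 'n) \<Rightarrow> bool" where
  "husler_reiss M Y \<longleftrightarrow>
     multivariate_pareto M Y \<and>
     (\<exists>\<Theta> \<in> sym_kernel_one_pos. \<exists>f c.
        (\<forall>y. 0 \<le> f y) \<and> distributed M lborel Y (\<lambda>y. ennreal (f y)) \<and> 0 < c \<and>
        (AE y in lborel. y \<in> pareto_domain \<longrightarrow> f y = c * gen_HR_exp (mu_HR \<Theta>) \<Theta> y))"

text \<open>
  Both notions depend on the law of \<open>Y\<close> only, and every law on \<open>real ^ 'n\<close> is that of a random
  vector on a probability space with underlying type \<open>real ^ 'n\<close>; so fixing this type for the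
  probability space loses no generality.
\<close>

definition multivariate_pareto_density :: "(real ^ 'n \<Rightarrow> real) \<Rightarrow> bool" where
  "multivariate_pareto_density f \<longleftrightarrow>
     (AE y in lborel. 0 \<le> f y) \<and>
     (\<exists>(M :: (real ^ 'n) measure) Y.
        multivariate_pareto M Y \<and> distributed M lborel Y (\<lambda>y. ennreal (f y)))"

definition husler_reiss_density :: "(real ^ 'n \<Rightarrow> real) \<Rightarrow> bool" where
  "husler_reiss_density f \<longleftrightarrow>
     (AE y in lborel. 0 \<le> f y) \<and>
     (\<exists>(M :: (real ^ 'n) measure) Y.
        husler_reiss M Y \<and> distributed M lborel Y (\<lambda>y. ennreal (f y)))"

end

theory Submission
  imports Defs "HOL-Real_Asymp.Real_Asymp"
begin

text \<open>
  In logarithmic coordinates \<open>x = log y\<close> the function becomes \<open>g(x) = exp (- \<nu>\<^sup>T x - x\<^sup>T \<Theta> x)\<close> with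
  \<open>\<nu> = \<mu> - 1\<close>, the domain becomes \<open>{x. max x > 0}\<close>, and \<open>g(x + s1) = exp(- s \<nu>\<^sup>T 1) g(x)\<close>.

  If \<open>\<nu>\<^sup>T 1 \<le> 0\<close>, then \<open>g\<close> does not decrease along \<open>1\<close> while the domain is mapped into a strictly
  smaller part of itself, so the integral is infinite. If \<open>v \<noteq> 0\<close>, \<open>v\<^sup>T 1 = 0\<close> and \<open>v\<^sup>T \<Theta> v \<le> 0\<close>, then
  all translates of the open unit cube by multiples of \<open>v\<close> stay in the domain, and
  \<open>g(x + tv) + g(x - tv) \<ge> 2 g(x)\<close>, so again the integral is infinite. Otherwise \<open>g\<close> decays
  exponentially on the domain.

  Homogeneity of order \<open>d + 1\<close> means \<open>\<nu>\<^sup>T 1 = 1\<close>. In that case a mass transport along \<open>1\<close> turns the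
  integral of \<open>g\<close> over \<open>{x\<^sub>j > 0}\<close> into that of \<open>exp(x\<^sub>j) g(x)\<close> over \<open>{0 < x\<^sub>k < 1}\<close>, for any \<open>k\<close>, and
  translating by \<open>w\<close> with \<open>w\<^sub>k = 0\<close> and \<open>2 \<Theta> w = e\<^sub>j - e\<^sub>k\<close> compares the slab integrals for \<open>j\<close> and \<open>k\<close>.
  All marginal probabilities agree iff \<open>\<Theta>\<^sup>+ \<nu> - diag(\<Theta>\<^sup>+) / 2\<close> is a constant vector,
  that is, iff \<open>\<mu>\<close> is the Huesler--Reiss value.
\<close>

section \<open>Symmetric matrices annihilating the vector of ones\<close>

lemma inner_one_one: "(1::real^'n) \<bullet> 1 = real CARD('n)"
  by (simp add: inner_vec_def)

lemma inner_one: "x \<bullet> (1::real^'n) = (\<Sum>i\<in>UNIV. x $ i)" "(1::real^'n) \<bullet> x = (\<Sum>i\<in>UNIV. x $ i)"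
  by (simp_all add: inner_vec_def)

lemma symmetric_inner_commute:
  fixes A :: "real^'n^'n"
  assumes "transpose A = A"
  shows "x \<bullet> (A *v y) = (A *v x) \<bullet> y"
  by (metis assms dot_lmul_matrix vector_transpose_matrix)

lemma inner_matrix_vector_add:
  fixes A :: "real^'n^'n"
  assumes "transpose A = A"
  shows "(x + y) \<bullet> (A *v (x + y)) = x \<bullet> (A *v x) + 2 * (x \<bullet> (A *v y)) + y \<bullet> (A *v y)"
  using symmetric_inner_commute[OF assms, of x y]
  by (simp add: matrix_vector_right_distrib inner_add inner_commute)

lemma sym_kernel_oneD:
  assumes "\<Theta> \<in> sym_kernel_one"
  shows "transpose \<Theta> = \<Theta>" "\<Theta> *v 1 = 0" "(\<Theta> *v x) \<bullet> 1 = 0"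
  using assms symmetric_inner_commute[of \<Theta> x 1]
  by (auto simp: sym_kernel_one_def)

text \<open>Perturb \<open>x\<close> to \<open>x + t *\<^sub>R y\<close> with
  \<open>y = A *v x\<close>. The form becomes 2t|y|^2 + t^2 (y \<bullet> A y), which is negative for
  small negative t unless y = 0.\<close>

lemma pos_semidef_null:
  assumes "pos_semidef A" "x \<bullet> (A *v x) = 0"
  shows "A *v x = 0"
proof -
  have sym: "transpose A = A" using assms(1) by (simp add: pos_semidef_def)
  define y where "y = A *v x"
  have nonneg: "0 \<le> 2 * t * (y \<bullet> y) + t\<^sup>2 * (y \<bullet> (A *v y))" for t
  proof -
    have "0 \<le> (x + t *\<^sub>R y) \<bullet> (A *v (x + t *\<^sub>R y))"
      using assms(1) by (simp add: pos_semidef_def)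
    also have "\<dots> = 2 * t * (y \<bullet> y) + t\<^sup>2 * (y \<bullet> (A *v y))"
      using assms(2) symmetric_inner_commute[OF sym, of x y]
      by (simp add: inner_matrix_vector_add[OF sym] matrix_vector_mult_scaleR y_def power2_eq_square)
    finally show ?thesis .
  qed
  define c where "c = y \<bullet> (A *v y)"
  have "c \<ge> 0" using assms(1) by (simp add: pos_semidef_def c_def)
  show ?thesis
  proof (cases "y \<bullet> y = 0")
    case True then show ?thesis by (simp add: y_def)
  next
    case False
    then have pos: "y \<bullet> y > 0" by simp
    \<comment> \<open>The step t = -s is small enough for the linear term to dominate. The summand 1
      keeps the denominator positive when \<open>c = 0\<close>.\<close>
    define s where "s = (y \<bullet> y) / (c + 1)"
    have s: "s > 0" using pos \<open>c \<ge> 0\<close> by (simp add: s_def)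
    have yy: "y \<bullet> y = s * (c + 1)" using \<open>c \<ge> 0\<close> by (simp add: s_def)
    have "0 \<le> 2 * (- s) * (s * (c + 1)) + (- s)\<^sup>2 * c"
      using nonneg[of "- s"] yy by (simp add: c_def)
    also have "\<dots> = - (s\<^sup>2 * (c + 2))" by (simp add: power2_eq_square algebra_simps)
    also have "\<dots> < 0" using s \<open>c \<ge> 0\<close> by simp
    finally show ?thesis by simp
  qed
qed

section \<open>The hyperplane orthogonal to the vector of ones\<close>

lemma hyperplane_one: "dim {x::real^'n. x \<bullet> 1 = 0} = CARD('n) - 1" "subspace {x::real^'n. x \<bullet> 1 = 0}"
proof -
  have "{x::real^'n. x \<bullet> 1 = 0} = {x. 1 \<bullet> x = 0}" by (simp add: inner_commute)
  then show "dim {x::real^'n. x \<bullet> 1 = 0} = CARD('n) - 1" "subspace {x::real^'n. x \<bullet> 1 = 0}"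
    by (simp_all add: dim_hyperplane subspace_hyperplane one_neq_zero)
qed

text \<open>This is the orthogonal projection onto the hyperplane orthogonal to
  \<open>1\<close>.\<close>

definition centre :: "real^'n \<Rightarrow> real^'n" where
  "centre x = x - (x \<bullet> 1 / real CARD('n)) *\<^sub>R 1"

lemma centre_inner_one: "centre x \<bullet> 1 = 0"
  by (simp add: centre_def inner_diff_left inner_one_one)

lemma
  assumes "\<Theta> \<in> sym_kernel_one"
  shows mult_centre: "\<Theta> *v centre x = \<Theta> *v x"
    and quadratic_centre: "centre x \<bullet> (\<Theta> *v centre x) = x \<bullet> (\<Theta> *v x)"
proof -
  show *: "\<Theta> *v centre x = \<Theta> *v x"
    by (simp add: centre_def matrix_vector_mult_diff_distrib matrix_vector_mult_scaleR
        sym_kernel_oneD(2)[OF assms])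
  show "centre x \<bullet> (\<Theta> *v centre x) = x \<bullet> (\<Theta> *v x)"
    unfolding * using sym_kernel_oneD(3)[OF assms, of x] by (simp add: centre_def inner_diff_left inner_diff_right inner_commute)
qed

text \<open>The range of \<Theta> lies in the hyperplane orthogonal to \<open>1\<close>, and rank d
  - 1 makes it the whole hyperplane. A null vector v there is then of the form \<Theta> u, so v
  \<bullet> v = \<Theta> v \<bullet> u = 0. Conversely, definiteness makes \<Theta> injective on the
  hyperplane, which gives the rank. The failure of this criterion supplies the direction along which
  the integral diverges.\<close>

lemma sym_kernel_one_pos_iff:
  fixes \<Theta> :: "real^'n^'n"
  assumes "\<Theta> \<in> sym_kernel_one"
  shows "\<Theta> \<in> sym_kernel_one_pos \<longleftrightarrow> (\<forall>v. v \<bullet> 1 = 0 \<and> v \<noteq> 0 \<longrightarrow> v \<bullet> (\<Theta> *v v) > 0)"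
proof -
  let ?H = "{x::real^'n. x \<bullet> 1 = 0}"
  have range_sub: "range ((*v) \<Theta>) \<subseteq> ?H" using sym_kernel_oneD(3)[OF assms] by auto
  show ?thesis
  proof
    assume "\<Theta> \<in> sym_kernel_one_pos"
    then have psd: "pos_semidef \<Theta>" and rk: "rank \<Theta> = CARD('n) - 1"
      by (auto simp: sym_kernel_one_pos_def)
    have range: "range ((*v) \<Theta>) = ?H"
      using rk by (intro subspace_dim_equal range_sub linear_subspace_image)
        (auto simp: hyperplane_one rank_dim_range)
    show "\<forall>v. v \<bullet> 1 = 0 \<and> v \<noteq> 0 \<longrightarrow> v \<bullet> (\<Theta> *v v) > 0"
    proof (intro allI impI)
      fix v :: "real^'n" assume v: "v \<bullet> 1 = 0 \<and> v \<noteq> 0"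
      have "v \<bullet> (\<Theta> *v v) \<noteq> 0"
      proof
        assume "v \<bullet> (\<Theta> *v v) = 0"
        then have 0: "\<Theta> *v v = 0" using pos_semidef_null psd by blast
        obtain u where "v = \<Theta> *v u" using range v by (metis (mono_tags) imageE mem_Collect_eq)
        then have "v \<bullet> v = 0"
          using 0 symmetric_inner_commute[OF sym_kernel_oneD(1)[OF assms], of v u] by simp
        then show False using v by simp
      qed
      then show "v \<bullet> (\<Theta> *v v) > 0" using psd by (simp add: pos_semidef_def order_less_le)
    qed
  next
    assume pos: "\<forall>v. v \<bullet> 1 = 0 \<and> v \<noteq> 0 \<longrightarrow> v \<bullet> (\<Theta> *v v) > 0"
    have "0 \<le> x \<bullet> (\<Theta> *v x)" for x
      using pos[rule_format, of "centre x"] quadratic_centre[OF assms, of x] centre_inner_one[of x]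
      by (cases "centre x = 0") auto
    then have psd: "pos_semidef \<Theta>" using assms by (auto simp: pos_semidef_def sym_kernel_one_def)
    have "range ((*v) \<Theta>) = (*v) \<Theta> ` ?H"
    proof -
      have "\<Theta> *v x \<in> (*v) \<Theta> ` ?H" for x
        using centre_inner_one[of x] mult_centre[OF assms, of x] by (metis (mono_tags) imageI mem_Collect_eq)
      then show ?thesis by auto
    qed
    moreover have "inj_on ((*v) \<Theta>) (span ?H)"
    proof (rule inj_onI)
      fix x y assume xy: "x \<in> span ?H" "y \<in> span ?H" "\<Theta> *v x = \<Theta> *v y"
      then have "x \<bullet> 1 = 0" "y \<bullet> 1 = 0"
        by (metis (mono_tags, lifting) hyperplane_one(2) mem_Collect_eq span_eq_iff)+
      then have "(x - y) \<bullet> 1 = 0" by (simp add: inner_diff_left)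
      moreover have "(x - y) \<bullet> (\<Theta> *v (x - y)) = 0"
        using xy(3) by (simp add: matrix_vector_mult_diff_distrib)
      ultimately show "x = y" using pos by (metis order_less_irrefl right_minus_eq)
    qed
    ultimately have "rank \<Theta> = dim ?H"
      by (simp add: rank_dim_range dim_image_eq)
    then show "\<Theta> \<in> sym_kernel_one_pos"
      using assms psd by (simp add: sym_kernel_one_pos_def hyperplane_one)
  qed
qed

section \<open>The pseudoinverse and the Huesler--Reiss parameter\<close>

lemma
  fixes A B :: "real^'n^'m" and C D :: "real^'k^'n"
  shows matrix_add_rdistrib: "(A + B) ** C = A ** C + B ** C"
    and matrix_diff_rdistrib: "(A - B) ** C = A ** C - B ** C"
    and matrix_diff_ldistrib: "A ** (C - D) = A ** C - A ** D"
  by (simp_all add: matrix_eq matrix_vector_mul_assoc[symmetric] matrix_vector_mult_add_rdistrib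
      matrix_vector_mult_diff_rdistrib matrix_vector_mult_diff_distrib)

text \<open>With \<open>J\<close> the orthogonal projection onto the line through \<open>1\<close>,
  the matrix \<open>\<Theta> + J\<close> is invertible, and its inverse minus \<open>J\<close>
  satisfies the Penrose equations. Both products of \<Theta> with it are the centring projection
  \<open>mat 1 - J\<close>.\<close>

lemma pinv_sym_kernel_one_pos:
  fixes \<Theta> :: "real^'n^'n"
  assumes "\<Theta> \<in> sym_kernel_one_pos"
  shows "transpose (pinv \<Theta>) = pinv \<Theta>"
    and "pinv \<Theta> *v 1 = 0"
    and "\<Theta> *v (pinv \<Theta> *v x) = centre x"
    and "pinv \<Theta> *v (\<Theta> *v x) = centre x"
proof -
  have S: "\<Theta> \<in> sym_kernel_one" using assms by (simp add: sym_kernel_one_pos_def)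
  note sym = sym_kernel_oneD(1)[OF S]
  define J :: "real^'n^'n" where "J = (\<chi> i j. 1 / real CARD('n))"
  have J: "J *v x = (x \<bullet> 1 / real CARD('n)) *\<^sub>R 1" for x
    by (simp add: J_def vec_eq_iff matrix_vector_mult_def inner_one sum_divide_distrib)
  have Jsym: "transpose J = J" by (simp add: J_def transpose_def)
  have I: "(mat 1 - J) *v x = centre x" for x
    by (simp add: matrix_vector_mult_diff_rdistrib J centre_def)
  have ker: "x = 0" if "(\<Theta> + J) *v x = 0" for x
  proof -
    \<comment> \<open>Pairing the equation with \<open>x\<close> yields a sum of two nonnegative
      terms, so both vanish.\<close>
    have "0 = centre x \<bullet> (\<Theta> *v centre x) + (x \<bullet> 1)\<^sup>2 / real CARD('n)"
      using arg_cong[OF that, of "\<lambda>y. x \<bullet> y"]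
      by (simp add: matrix_vector_mult_add_rdistrib inner_add_right J quadratic_centre[OF S] power2_eq_square)
    moreover have "centre x \<bullet> (\<Theta> *v centre x) \<ge> 0"
      using assms by (simp add: sym_kernel_one_pos_def pos_semidef_def)
    moreover have "(x \<bullet> 1)\<^sup>2 / real CARD('n) \<ge> 0" by simp
    ultimately have "centre x \<bullet> (\<Theta> *v centre x) = 0" "(x \<bullet> 1)\<^sup>2 / real CARD('n) = 0" by linarith+
    then have "centre x = 0" "x \<bullet> 1 = 0"
      using assms sym_kernel_one_pos_iff[OF S] centre_inner_one[of x] by fastforce+
    then show ?thesis by (simp add: centre_def)
  qed
  obtain N where N: "N ** (\<Theta> + J) = mat 1"
    using ker matrix_left_invertible_ker by blast
  then have N': "(\<Theta> + J) ** N = mat 1" using matrix_left_right_inverse by blast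
  have JT: "J ** \<Theta> = 0" "\<Theta> ** J = 0"
    using sym_kernel_oneD(2,3)[OF S]
    by (simp_all add: matrix_eq matrix_vector_mul_assoc[symmetric] J matrix_vector_mult_scaleR)
  have JJ: "J ** J = J"
    by (simp add: matrix_eq matrix_vector_mul_assoc[symmetric] J inner_one_one)
  have NJ: "N ** J = J"
  proof -
    have "N ** J = N ** ((\<Theta> + J) ** J)" by (simp add: matrix_add_rdistrib JT JJ)
    then show ?thesis by (simp add: matrix_mul_assoc N)
  qed
  have JN: "J ** N = J"
  proof -
    have "J ** N = (J ** (\<Theta> + J)) ** N" by (simp add: matrix_add_ldistrib JT JJ)
    then show ?thesis by (simp add: matrix_mul_assoc[symmetric] N')
  qed
  have Nsym: "transpose N = N"
  proof -
    have "transpose (\<Theta> + J) = \<Theta> + J" using sym Jsym by (simp add: transpose_def vec_eq_iff)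
    then have "transpose N ** (\<Theta> + J) = transpose ((\<Theta> + J) ** N)"
      by (simp add: matrix_transpose_mul)
    also have "\<dots> = mat 1" by (simp add: N' transpose_mat)
    finally have "transpose N ** (\<Theta> + J) ** N = N" by simp
    then show ?thesis by (simp add: matrix_mul_assoc[symmetric] N')
  qed
  define B where "B = N - J"
  have TB: "\<Theta> ** B = mat 1 - J"
  proof -
    have "\<Theta> ** B = \<Theta> ** N - \<Theta> ** J" by (simp add: B_def matrix_diff_ldistrib)
    moreover have "\<Theta> ** N = mat 1 - J ** N"
      using N' by (simp add: matrix_add_rdistrib eq_diff_eq)
    ultimately show ?thesis by (simp add: JT JN)
  qed
  have BT: "B ** \<Theta> = mat 1 - J"
  proof -
    have "B ** \<Theta> = N ** \<Theta> - J ** \<Theta>" by (simp add: B_def matrix_diff_rdistrib)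
    moreover have "N ** \<Theta> = mat 1 - N ** J"
      using N by (simp add: matrix_add_ldistrib eq_diff_eq)
    ultimately show ?thesis by (simp add: JT NJ)
  qed
  have JB: "J ** B = 0" by (simp add: B_def matrix_diff_ldistrib JN JJ)
  have BJ: "B ** J = 0" by (simp add: B_def matrix_diff_rdistrib NJ JJ)
  have "transpose (mat 1 - J) = mat 1 - J"
    using Jsym transpose_mat[of 1] by (simp add: transpose_def vec_eq_iff mat_def)
  then have "penrose_inverse \<Theta> B"
    by (simp add: penrose_inverse_def TB BT matrix_diff_rdistrib JT JB)
  then have B: "pinv \<Theta> = B" by (rule pinv_eqI)
  show "transpose (pinv \<Theta>) = pinv \<Theta>"
    using Nsym Jsym by (simp add: B B_def transpose_def vec_eq_iff)
  have "J *v 1 = 1" by (simp add: J inner_one_one)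
  then show "pinv \<Theta> *v 1 = 0"
    using BJ by (metis B matrix_vector_mul_assoc matrix_vector_mult_0)
  show "\<Theta> *v (pinv \<Theta> *v x) = centre x" "pinv \<Theta> *v (\<Theta> *v x) = centre x"
    by (simp_all add: matrix_vector_mul_assoc B TB BT I)
qed

text \<open>The rows of the pseudoinverse sum to zero, so the variogram applied to \<open>1\<close>
  is a multiple of \<open>1\<close> plus d times the diagonal, and \<Theta> kills the multiple of
  \<open>1\<close>.\<close>

lemma mu_HR_eq:
  fixes \<Theta> :: "real^'n^'n"
  assumes "\<Theta> \<in> sym_kernel_one_pos"
  shows "mu_HR \<Theta> = (1 + 1 / real CARD('n)) *\<^sub>R 1 + (1/2) *\<^sub>R (\<Theta> *v diag_vec (pinv \<Theta>))"
proof -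
  have S: "\<Theta> \<in> sym_kernel_one" using assms by (simp add: sym_kernel_one_pos_def)
  let ?g = "diag_vec (pinv \<Theta>)"
  have B1: "(\<Sum>j\<in>UNIV. pinv \<Theta> $ i $ j) = 0" for i
    using pinv_sym_kernel_one_pos(2)[OF assms] by (simp add: vec_eq_iff matrix_vector_mult_def)
  have "variogram \<Theta> *v 1 = (?g \<bullet> 1) *\<^sub>R 1 + real CARD('n) *\<^sub>R ?g"
    by (simp add: vec_eq_iff variogram_def matrix_vector_mult_def inner_one sum.distrib sum_subtractf
        sum_distrib_left[symmetric] B1)
  then have "(\<Theta> ** variogram \<Theta>) *v 1 = real CARD('n) *\<^sub>R (\<Theta> *v ?g)"
    by (simp add: matrix_vector_mul_assoc[symmetric] matrix_vector_right_distrib matrix_vector_mult_scaleR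
        sym_kernel_oneD(2)[OF S])
  then show ?thesis by (simp add: mu_HR_def)
qed

text \<open>The range of \<Theta> is orthogonal to \<open>1\<close>, so only the constant part
  contributes. The value is the homogeneity order demanded of a Pareto density.\<close>

lemma mu_HR_inner_one:
  fixes \<Theta> :: "real^'n^'n"
  assumes "\<Theta> \<in> sym_kernel_one_pos"
  shows "mu_HR \<Theta> \<bullet> 1 = real CARD('n) + 1"
proof -
  have "\<Theta> \<in> sym_kernel_one" using assms by (simp add: sym_kernel_one_pos_def)
  then show ?thesis
    using sym_kernel_oneD(3)[of \<Theta> "diag_vec (pinv \<Theta>)"]
    by (simp add: mu_HR_eq[OF assms] inner_add_left inner_one_one field_simps)
qed

text \<open>Applying \<Theta> to \<open>u\<close> gives the centred \<open>\<mu> - 1\<close> minus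
  half of \<Theta> times the diagonal of the pseudoinverse, which vanishes when \<open>u\<close> is
  constant; the sum condition on \<mu> supplies the component along \<open>1\<close>. The
  differences of the entries of \<open>u\<close> reappear as logarithms of ratios of marginal
  probabilities.\<close>

lemma eq_mu_HR_iff:
  fixes \<Theta> :: "real^'n^'n"
  assumes "\<Theta> \<in> sym_kernel_one_pos" "\<mu> \<bullet> 1 = real CARD('n) + 1"
  defines "u \<equiv> pinv \<Theta> *v (\<mu> - 1) - (1/2) *\<^sub>R diag_vec (pinv \<Theta>)"
  shows "\<mu> = mu_HR \<Theta> \<longleftrightarrow> (\<forall>j k. u $ j = u $ k)"
proof -
  have S: "\<Theta> \<in> sym_kernel_one" using assms by (simp add: sym_kernel_one_pos_def)
  note B = pinv_sym_kernel_one_pos[OF assms(1)]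
  let ?g = "diag_vec (pinv \<Theta>)"
  show ?thesis
  proof
    assume "\<mu> = mu_HR \<Theta>"
    then have "\<mu> - 1 = (1 / real CARD('n)) *\<^sub>R 1 + (1/2) *\<^sub>R (\<Theta> *v ?g)"
      by (simp add: mu_HR_eq[OF assms(1)] scaleR_add_left)
    then have "pinv \<Theta> *v (\<mu> - 1) = (1/2) *\<^sub>R centre ?g"
      by (simp add: matrix_vector_right_distrib matrix_vector_mult_scaleR B)
    then have "u = - (?g \<bullet> 1 / (2 * real CARD('n))) *\<^sub>R 1"
      by (simp add: u_def centre_def scaleR_diff_right)
    then show "\<forall>j k. u $ j = u $ k" by simp
  next
    assume eq: "\<forall>j k. u $ j = u $ k"
    \<comment> \<open>\<open>undefined\<close> stands for an arbitrary index; all entries of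
      \<open>u\<close> agree.\<close>
    have "u = (u $ undefined) *\<^sub>R 1" using eq by (auto simp: vec_eq_iff)
    then have "\<Theta> *v u = 0"
      by (metis matrix_vector_mult_scaleR scaleR_zero_right sym_kernel_oneD(2)[OF S])
    then have "centre (\<mu> - 1) = (1/2) *\<^sub>R (\<Theta> *v ?g)"
      unfolding u_def by (subst (asm) matrix_vector_mult_diff_distrib)
        (simp only: matrix_vector_mult_scaleR B right_minus_eq)
    moreover have "centre (\<mu> - 1) = \<mu> - (1 + 1 / real CARD('n)) *\<^sub>R 1"
      by (simp add: centre_def inner_diff_left assms(2) inner_one_one scaleR_add_left)
    ultimately show "\<mu> = mu_HR \<Theta>" by (simp add: mu_HR_eq[OF assms(1)] algebra_simps)
  qed
qed

section \<open>Logarithmic coordinates\<close>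

lemma measurable_vec_nth [measurable]: "(\<lambda>x::real^'n. x $ i) \<in> borel_measurable borel"
  by (intro borel_measurable_continuous_onI continuous_intros)

lemma measurable_matrix_vector_mult [measurable]:
  "(\<lambda>x. (A::real^'n^'m) *v x) \<in> borel_measurable borel"
  by (intro borel_measurable_continuous_onI matrix_vector_mult_linear_continuous_on)

lemma measurable_ln_vec [measurable]: "(ln_vec :: real^'n \<Rightarrow> _) \<in> borel_measurable borel"
  by (subst borel_measurable_euclidean_space)
    (auto simp: Basis_vec_def inner_axis ln_vec_def intro!: borel_measurable_ln)

lemma measurable_gen_HR_exp [measurable]: "gen_HR_exp \<mu> \<Theta> \<in> borel_measurable borel"
  unfolding gen_HR_exp_def[abs_def] by measurable

lemma mem_pareto_domain: "y \<in> pareto_domain \<longleftrightarrow> (\<forall>i. 0 \<le> y $ i) \<and> (\<exists>i. 1 < y $ i)"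
  by (simp add: pareto_domain_def less_eq_vec_def) (meson not_le)

lemma pareto_domain_borel [measurable]: "pareto_domain \<in> sets borel"
proof -
  have "pareto_domain = {y \<in> space borel. (\<forall>i. 0 \<le> y $ i) \<and> (\<exists>i. 1 < y $ i)}"
    by (auto simp: mem_pareto_domain)
  also have "\<dots> \<in> sets borel" by measurable
  finally show ?thesis .
qed

section \<open>Change of variables to logarithmic coordinates\<close>

lemma prod_Basis_vec:
  fixes f :: "real^'n \<Rightarrow> 'b::comm_monoid_mult"
  shows "(\<Prod>b\<in>Basis. f b) = (\<Prod>i\<in>UNIV. f (axis i (1::real)))"
proof -
  have "(Basis :: (real^'n) set) = range (\<lambda>i. axis i 1)" by (auto simp: Basis_vec_def)
  moreover have "inj (\<lambda>i. axis i 1 :: real^'n)" by (auto simp: inj_def axis_eq_axis)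
  ultimately show ?thesis by (metis (no_types, lifting) prod.reindex_cong)
qed

text \<open>This is the one-dimensional change of variables: the logarithm carries dt/t to Lebesgue
  measure. The endpoints are null, so the fundamental theorem on the closed interval
  applies.\<close>

lemma nn_integral_inverse_exp_interval:
  assumes "l \<le> u"
  shows "(\<integral>\<^sup>+t. ennreal (1 / t) * indicator {exp l<..<exp u} t \<partial>lborel) = ennreal (u - l)"
proof -
  have "(\<integral>\<^sup>+t. ennreal (1 / t) * indicator {exp l<..<exp u} t \<partial>lborel) =
      (\<integral>\<^sup>+t. ennreal (1 / t) * indicator {exp l..exp u} t \<partial>lborel)"
  proof (rule nn_integral_cong_AE)
    show "AE t in lborel. ennreal (1 / t) * indicator {exp l<..<exp u} t =
        ennreal (1 / t) * indicator {exp l..exp u} t"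
      using AE_lborel_singleton[of "exp l"] AE_lborel_singleton[of "exp u"]
      by eventually_elim (auto simp: indicator_def)
  qed
  also have "\<dots> = ennreal (ln (exp u) - ln (exp l))"
  proof (rule nn_integral_FTC_Icc)
    fix t assume t: "t \<in> {exp l..exp u}"
    then have "t > 0" using exp_gt_zero[of l] by (simp del: exp_gt_zero)
    then show "DERIV ln t :> 1 / t" "0 \<le> 1 / t" by (auto intro: DERIV_ln_divide)
  qed (use assms in auto)
  finally show ?thesis by simp
qed

text \<open>The Jacobian factor of the coordinatewise logarithm. The indicators discard points with
  a nonpositive coordinate, where \<open>ln_vec\<close> has no meaning as a change of
  variables.\<close>

definition log_weight :: "real^'n \<Rightarrow> ennreal" where
  "log_weight y = (\<Prod>i\<in>UNIV. ennreal (1 / y $ i) * indicator {0<..} (y $ i))"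

lemma measurable_log_weight [measurable]: "log_weight \<in> borel_measurable borel"
  unfolding log_weight_def[abs_def] by measurable

text \<open>Lebesgue measure is determined by its values on boxes. Within the positive orthant the
  preimage of a box is a product of intervals with exponential endpoints, and the weight factorises
  over the coordinates.\<close>

lemma lborel_eq_distr_ln_vec:
  "(lborel :: (real^'n) measure) = distr (density lborel log_weight) borel ln_vec"
proof (rule lborel_eqI)
  fix l u :: "real^'n" assume lu: "\<And>b. b \<in> Basis \<Longrightarrow> l \<bullet> b \<le> u \<bullet> b"
  let ?g = "\<lambda>b t. ennreal (1 / t) * indicator {exp (l \<bullet> b)<..<exp (u \<bullet> b)} t"
  have "emeasure (distr (density lborel log_weight) borel ln_vec) (box l u) =
      (\<integral>\<^sup>+y. log_weight y * indicator (ln_vec -` box l u) y \<partial>lborel)"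
    using measurable_sets_borel[OF measurable_ln_vec, of "box l u"]
    by (simp add: emeasure_distr emeasure_density)
  also have "\<dots> = (\<integral>\<^sup>+y. (\<Prod>b\<in>Basis. ?g b (y \<bullet> b)) \<partial>lborel)"
  proof (rule nn_integral_cong)
    fix y :: "real^'n"
    have mem: "0 < t \<and> a < ln t \<and> ln t < b \<longleftrightarrow> exp a < t \<and> t < exp b" for t a b :: real
      using exp_gt_zero[of a] by (metis exp_less_mono exp_ln ln_exp ln_less_cancel_iff order_less_trans exp_gt_zero)
    show "log_weight y * indicator (ln_vec -` box l u) y = (\<Prod>b\<in>Basis. ?g b (y \<bullet> b))"
    proof (cases "\<forall>i. exp (l $ i) < y $ i \<and> y $ i < exp (u $ i)")
      case True
      then have "\<forall>i. 0 < y $ i \<and> l $ i < ln (y $ i) \<and> ln (y $ i) < u $ i" using mem by blast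
      then show ?thesis using True
        by (simp add: log_weight_def prod_Basis_vec inner_axis mem_box_cart ln_vec_def)
    next
      case False
      then obtain i where i: "\<not> (0 < y $ i \<and> l $ i < ln (y $ i) \<and> ln (y $ i) < u $ i)"
        "\<not> (exp (l $ i) < y $ i \<and> y $ i < exp (u $ i))" using mem by blast
      have "(\<Prod>b\<in>Basis. ?g b (y \<bullet> b)) = 0"
        using i(2) by (auto simp: prod_Basis_vec inner_axis indicator_def intro!: prod_zero exI[of _ i])
      moreover have "log_weight y * indicator (ln_vec -` box l u) y = 0"
      proof (cases "0 < y $ i")
        case True then show ?thesis using i(1) by (auto simp: mem_box_cart ln_vec_def indicator_def)
      next
        case False then show ?thesis by (auto simp: log_weight_def indicator_def intro!: prod_zero exI[of _ i])
      qed
      ultimately show ?thesis by (simp only:)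
    qed
  qed
  also have "\<dots> = (\<Prod>b\<in>Basis. (\<integral>\<^sup>+t. ?g b t \<partial>lborel))"
    by (rule nn_integral_lborel_prod) auto
  also have "\<dots> = (\<Prod>b\<in>Basis. ennreal (u \<bullet> b - l \<bullet> b))"
    using lu by (intro prod.cong refl nn_integral_inverse_exp_interval)
  also have "\<dots> = ennreal (\<Prod>b\<in>Basis. (u - l) \<bullet> b)"
    using lu by (simp add: prod_ennreal inner_diff_left)
  finally show "emeasure (distr (density lborel log_weight) borel ln_vec) (box l u) =
      ennreal (\<Prod>b\<in>Basis. (u - l) \<bullet> b)" .
qed simp

text \<open>The integrand in logarithmic coordinates. It is used with
  \<open>\<nu> = \<mu> - 1\<close>, the shift by \<open>1\<close> coming from the Jacobian.\<close>

definition log_density :: "real^'n \<Rightarrow> real^'n^'n \<Rightarrow> real^'n \<Rightarrow> real" where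
  "log_density \<nu> \<Theta> x = exp (- (\<nu> \<bullet> x) - x \<bullet> (\<Theta> *v x))"

lemma log_density_pos: "0 < log_density \<nu> \<Theta> x"
  by (simp add: log_density_def)

lemma measurable_log_density [measurable]: "log_density \<nu> \<Theta> \<in> borel_measurable borel"
  unfolding log_density_def[abs_def] by measurable

lemma AE_nth_nonzero: "AE y in lborel. \<forall>i. (y::real^'n) $ i \<noteq> 0"
proof -
  have "AE y in lborel. (y::real^'n) $ i \<noteq> 0" for i
  proof -
    have "{y::real^'n. y $ i = 0} \<in> null_sets lborel"
    proof -
      have "{y::real^'n. y $ i = 0} \<in> sets borel"
        using borel_measurable_eq[of "\<lambda>y. y $ i" borel "\<lambda>_. 0"] by simp
      then show ?thesis
        using negligible_standard_hyperplane_cart[of i] negligible_iff_null_sets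
          null_sets_completion_iff by (metis sets_lborel)
    qed
    then show ?thesis by (rule AE_I') auto
  qed
  then show ?thesis by (simp add: AE_all_countable)
qed

lemma AE_imp_ex_mem:
  assumes "AE x in lborel. P x" "U \<in> sets borel" "emeasure lborel U > 0"
  shows "\<exists>x\<in>U. P x"
proof (rule ccontr)
  assume "\<not> ?thesis"
  then have "AE x in lborel. x \<notin> U" using assms(1) by (auto elim: eventually_mono)
  then have "emeasure lborel U = 0"
    using assms(2) by (subst (asm) AE_iff_measurable[of U]) auto
  then show False using assms(3) by simp
qed

text \<open>The regions \<open>S\<close> and \<open>T\<close> have to correspond only on the open
  positive orthant, because \<open>S\<close> lies in the closed orthant and its boundary is null.
  One substitution thus serves both the full domain and the marginal events.\<close>

lemma nn_integral_gen_HR_exp: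
  fixes \<mu> :: "real^'n"
  assumes [measurable]: "T \<in> sets borel"
    and S: "\<And>y. y \<in> S \<Longrightarrow> \<forall>i. 0 \<le> y $ i"
    and ST: "\<And>y. \<forall>i. 0 < y $ i \<Longrightarrow> y \<in> S \<longleftrightarrow> ln_vec y \<in> T"
  shows "(\<integral>\<^sup>+y. ennreal (gen_HR_exp \<mu> \<Theta> y) * indicator S y \<partial>lborel) =
    (\<integral>\<^sup>+x. ennreal (log_density (\<mu> - 1) \<Theta> x) * indicator T x \<partial>lborel)"
proof -
  have "(\<integral>\<^sup>+x. ennreal (log_density (\<mu> - 1) \<Theta> x) * indicator T x \<partial>lborel) =
    (\<integral>\<^sup>+y. log_weight y * (ennreal (log_density (\<mu> - 1) \<Theta> (ln_vec y)) * indicator T (ln_vec y)) \<partial>lborel)"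
    by (subst lborel_eq_distr_ln_vec) (simp add: nn_integral_distr nn_integral_density)
  also have "\<dots> = (\<integral>\<^sup>+y. ennreal (gen_HR_exp \<mu> \<Theta> y) * indicator S y \<partial>lborel)"
  proof (rule nn_integral_cong_AE)
    show "AE y in lborel. log_weight y * (ennreal (log_density (\<mu> - 1) \<Theta> (ln_vec y)) *
        indicator T (ln_vec y)) = ennreal (gen_HR_exp \<mu> \<Theta> y) * indicator S y"
      using AE_nth_nonzero
    proof eventually_elim
      case (elim y)
      show ?case
      proof (cases "\<forall>i. 0 < y $ i")
        case True
        have "log_weight y = ennreal (\<Prod>i\<in>UNIV. 1 / y $ i)"
          using True by (simp add: log_weight_def prod_ennreal less_imp_le)
        \<comment> \<open>This factor turns the parameter \<open>\<mu> - 1\<close> back into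
          \<mu>.\<close>
        also have "(\<Prod>i\<in>UNIV. 1 / y $ i) = exp (- (1 \<bullet> ln_vec y))"
          using True by (simp add: inner_one ln_vec_def exp_minus exp_sum prod_dividef inverse_eq_divide)
        finally have "log_weight y * ennreal (log_density (\<mu> - 1) \<Theta> (ln_vec y)) =
            ennreal (gen_HR_exp \<mu> \<Theta> y)"
          by (simp add: log_density_def gen_HR_exp_def ennreal_mult[symmetric] exp_add[symmetric]
              inner_diff_left)
        then show ?thesis using ST[OF True] by (simp add: mult.assoc[symmetric] indicator_def)
      next
        case False
        then obtain i where i: "y $ i < 0" using elim by (metis linorder_neqE_linordered_idom)
        then have "y \<notin> S" using S[of y] by (meson not_le)
        moreover have "log_weight y = 0"
          using i by (auto simp: log_weight_def indicator_def intro!: prod_zero exI[of _ i])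
        ultimately show ?thesis by simp
      qed
    qed
  qed
  finally show ?thesis by simp
qed

lemma nn_integral_lborel_translate:
  assumes [measurable]: "f \<in> borel_measurable borel"
  shows "(\<integral>\<^sup>+x. f (c + x) \<partial>lborel) = (\<integral>\<^sup>+x. f x \<partial>lborel)"
  by (subst (2) lborel_distr_plus[of c, symmetric]) (simp add: nn_integral_distr)

lemma set_integrable_gen_HR_exp_iff:
  "set_integrable lborel pareto_domain (gen_HR_exp \<mu> \<Theta>) \<longleftrightarrow>
    (\<integral>\<^sup>+x. ennreal (log_density (\<mu> - 1) \<Theta> x) * indicator {x. \<exists>i. 0 < x $ i} x \<partial>lborel) < \<infinity>"
proof -
  have [measurable]: "{x::real^'n. \<exists>i. 0 < x $ i} \<in> sets borel" by measurable
  have "set_integrable lborel pareto_domain (gen_HR_exp \<mu> \<Theta>) \<longleftrightarrow>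
    (\<integral>\<^sup>+y. ennreal (gen_HR_exp \<mu> \<Theta> y) * indicator pareto_domain y \<partial>lborel) < \<infinity>"
  proof -
    have "ennreal (norm (indicator pareto_domain y *\<^sub>R gen_HR_exp \<mu> \<Theta> y)) =
        ennreal (gen_HR_exp \<mu> \<Theta> y) * indicator pareto_domain y" for y
      by (simp add: gen_HR_exp_def indicator_def)
    then show ?thesis by (simp add: set_integrable_def integrable_iff_bounded)
  qed
  also have "(\<integral>\<^sup>+y. ennreal (gen_HR_exp \<mu> \<Theta> y) * indicator pareto_domain y \<partial>lborel) =
    (\<integral>\<^sup>+x. ennreal (log_density (\<mu> - 1) \<Theta> x) * indicator {x. \<exists>i. 0 < x $ i} x \<partial>lborel)"
    by (rule nn_integral_gen_HR_exp) (auto simp: mem_pareto_domain ln_vec_def less_imp_le)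
  finally show ?thesis .
qed

section \<open>Divergence of the integral\<close>

text \<open>A translation multiplies the density by the exponential of an affine function of
  \<open>x\<close>, since the pure quadratic part in \<open>x\<close> cancels.\<close>

lemma log_density_add:
  assumes "\<Theta> \<in> sym_kernel_one"
  shows "log_density \<nu> \<Theta> (w + x) =
    exp (- (\<nu> \<bullet> w) - w \<bullet> (\<Theta> *v w) - 2 * (x \<bullet> (\<Theta> *v w))) * log_density \<nu> \<Theta> x"
  using inner_matrix_vector_add[OF sym_kernel_oneD(1)[OF assms], of x w]
  by (simp add: log_density_def exp_add[symmetric] inner_add_right add.commute)

lemma log_density_shift_one:
  assumes "\<Theta> \<in> sym_kernel_one"
  shows "log_density \<nu> \<Theta> (s *\<^sub>R 1 + x) = exp (- s * (\<nu> \<bullet> 1)) * log_density \<nu> \<Theta> x"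
  by (simp add: log_density_add[OF assms] matrix_vector_mult_scaleR sym_kernel_oneD(2)[OF assms])

abbreviation log_domain :: "(real^'n) set" where
  "log_domain \<equiv> {x. \<exists>i. 0 < x $ i}"

abbreviation log_halfspace :: "'n \<Rightarrow> (real^'n) set" where
  "log_halfspace k \<equiv> {x. 0 < x $ k}"

lemma log_domain_borel [measurable]: "(log_domain :: (real^'n) set) \<in> sets borel"
  by measurable

lemma log_halfspace_borel [measurable]: "log_halfspace k \<in> sets borel"
  by measurable

lemma nn_integral_log_density_pos:
  assumes [measurable]: "U \<in> sets borel" and U: "emeasure lborel U > 0"
  shows "0 < (\<integral>\<^sup>+x. ennreal (log_density \<nu> \<Theta> x) * indicator U x \<partial>lborel)"
proof (rule ccontr)
  assume "\<not> ?thesis"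
  then have "AE x in lborel. ennreal (log_density \<nu> \<Theta> x) * indicator U x = 0"
    by (subst (asm) not_gr_zero, subst (asm) nn_integral_0_iff_AE) auto
  from AE_imp_ex_mem[OF this _ U] obtain x where "x \<in> U" "ennreal (log_density \<nu> \<Theta> x) = 0" by auto
  then show False using log_density_pos[of \<nu> \<Theta> x] by (simp add: ennreal_eq_0_iff)
qed

lemma emeasure_box_pos:
  fixes l u :: "real^'n"
  assumes "\<And>i. l $ i < u $ i"
  shows "0 < emeasure lborel (box l u)"
  using assms by (subst emeasure_lborel_box)
    (auto simp: Basis_vec_def inner_axis less_imp_le inner_diff_left intro!: prod_pos)

text \<open>The cube \<open>?D\<close> is disjoint from the domain, but translation by
  \<open>1\<close> carries both into the domain without lowering the density. The integral therefore
  absorbs the positive mass of \<open>?D\<close>, which is impossible if it is finite.\<close>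

lemma log_density_not_integrable_drift:
  fixes \<nu> :: "real^'n"
  assumes S: "\<Theta> \<in> sym_kernel_one" and "\<nu> \<bullet> 1 \<le> 0"
  shows "(\<integral>\<^sup>+x. ennreal (log_density \<nu> \<Theta> x) * indicator log_domain x \<partial>lborel) = \<infinity>"
    (is "?N = _")
proof (rule ccontr)
  assume fin: "?N \<noteq> \<infinity>"
  let ?D = "box (-1) 0 :: (real^'n) set"
  let ?g = "log_density \<nu> \<Theta>"
  have D: "x \<in> ?D \<longleftrightarrow> (\<forall>i. -1 < x $ i \<and> x $ i < 0)" for x by (simp add: mem_box_cart)
  have pos: "0 < (\<integral>\<^sup>+x. ennreal (?g x) * indicator ?D x \<partial>lborel)"
    by (intro nn_integral_log_density_pos emeasure_box_pos) auto
  have "?N + (\<integral>\<^sup>+x. ennreal (?g x) * indicator ?D x \<partial>lborel) =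
      (\<integral>\<^sup>+x. ennreal (?g x) * indicator log_domain x + ennreal (?g x) * indicator ?D x \<partial>lborel)"
    by (subst nn_integral_add) auto
  also have "\<dots> \<le> (\<integral>\<^sup>+x. ennreal (?g (1 + x)) * indicator log_domain (1 + x) \<partial>lborel)"
  proof (rule nn_integral_mono)
    fix x :: "real^'n"
    have "?g x \<le> ?g (1 + x)"
      using log_density_shift_one[OF S, of \<nu> 1 x] assms(2) log_density_pos[of \<nu> \<Theta> x] by simp
    moreover have "indicator log_domain x + indicator ?D x \<le> (indicator log_domain (1 + x) :: ennreal)"
    proof (cases "x \<in> log_domain")
      case True
      then obtain i where "0 < x $ i" by blast
      then have "0 < (1 + x) $ i" by simp
      then have "1 + x \<in> log_domain" by blast
      moreover have "x \<notin> ?D" using \<open>0 < x $ i\<close> unfolding D by (metis order_less_asym)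
      ultimately show ?thesis by (simp add: indicator_def)
    next
      case False
      moreover have "1 + x \<in> log_domain" if "x \<in> ?D"
        using that[unfolded D, rule_format, of undefined] by (auto intro!: exI[of _ undefined])
      ultimately show ?thesis by (auto simp: indicator_def)
    qed
    ultimately have "ennreal (?g x) * (indicator log_domain x + indicator ?D x) \<le>
        ennreal (?g (1 + x)) * indicator log_domain (1 + x)"
      by (intro mult_mono) (auto simp: ennreal_leI)
    then show "ennreal (?g x) * indicator log_domain x + ennreal (?g x) * indicator ?D x \<le>
        ennreal (?g (1 + x)) * indicator log_domain (1 + x)"
      by (simp only: distrib_left)
  qed
  also have "\<dots> = ?N"
    by (rule nn_integral_lborel_translate) measurable
  finally have "?N + (\<integral>\<^sup>+x. ennreal (?g x) * indicator ?D x \<partial>lborel) \<le> ?N + 0" by simp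
  then have "(\<integral>\<^sup>+x. ennreal (?g x) * indicator ?D x \<partial>lborel) \<le> 0"
    using fin unfolding ennreal_add_left_cancel_le by simp
  then show False using pos by simp
qed

text \<open>Translates of a unit cube by integer multiples of a rescaled \<open>v\<close> are
  disjoint and stay in the domain. Opposite translates together carry at least twice the mass of the
  original cube, so the total mass is unbounded.\<close>

lemma log_density_not_integrable_direction:
  fixes v :: "real^'n"
  assumes S: "\<Theta> \<in> sym_kernel_one" and "v \<bullet> 1 = 0" "v \<noteq> 0" "v \<bullet> (\<Theta> *v v) \<le> 0"
  shows "(\<integral>\<^sup>+x. ennreal (log_density \<nu> \<Theta> x) * indicator log_domain x \<partial>lborel) = \<infinity>"
    (is "?N = _")
proof (rule ccontr)
  assume fin: "?N \<noteq> \<infinity>"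
  let ?g = "log_density \<nu> \<Theta>"
  have "\<exists>i. 0 < v $ i"
  proof (rule ccontr)
    assume "\<not> ?thesis"
    then have "\<forall>i. v $ i = 0"
      using assms(2) sum_nonneg_eq_0_iff[of UNIV "\<lambda>i. - v $ i"] by (simp add: inner_one sum_negf not_less)
    then show False using assms(3) by (simp add: vec_eq_iff)
  qed
  then obtain p where p: "0 < v $ p" by blast
  have "\<exists>i. v $ i < 0"
  proof (rule ccontr)
    assume "\<not> ?thesis"
    then have "\<forall>i. v $ i = 0"
      using assms(2) sum_nonneg_eq_0_iff[of UNIV "\<lambda>i. v $ i"] by (simp add: inner_one not_less)
    then show False using assms(3) by (simp add: vec_eq_iff)
  qed
  then obtain n where n: "v $ n < 0" by blast
  \<comment> \<open>Normalising coordinate \<open>p\<close> to 1 makes distinct integer translates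
    of the open unit cube disjoint in that coordinate.\<close>
  define w where "w = (1 / v $ p) *\<^sub>R v"
  have wp: "w $ p = 1" and wn: "w $ n < 0" using p n by (simp_all add: w_def divide_neg_pos)
  have "w \<bullet> (\<Theta> *v w) = (1 / v $ p)\<^sup>2 * (v \<bullet> (\<Theta> *v v))"
    by (simp add: w_def matrix_vector_mult_scaleR power2_eq_square)
  then have wq: "w \<bullet> (\<Theta> *v w) \<le> 0" using assms(4) by (simp add: mult_nonneg_nonpos)
  define U where "U = (box 0 1 :: (real^'n) set)"
  have U: "x \<in> U \<longleftrightarrow> (\<forall>i. 0 < x $ i \<and> x $ i < 1)" for x by (simp add: U_def mem_box_cart)
  have [measurable]: "U \<in> sets borel" by (simp add: U_def)
  define F where "F t = (\<integral>\<^sup>+x. ennreal (?g x) * indicator U (- (t *\<^sub>R w) + x) \<partial>lborel)" for t :: real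
  have F: "F t = (\<integral>\<^sup>+x. ennreal (?g (t *\<^sub>R w + x)) * indicator U x \<partial>lborel)" for t
    unfolding F_def
    by (subst nn_integral_lborel_translate[of _ "t *\<^sub>R w", symmetric]) simp_all
  have F0: "0 < F 0"
    unfolding F by (simp, intro nn_integral_log_density_pos) (auto simp: U_def intro!: emeasure_box_pos)
  \<comment> \<open>The linear parts of the exponents are opposite and add up to 2 cosh a, at least
    2; the quadratic part contributes a factor at least 1 because the form is nonpositive at
    \<open>w\<close>.\<close>
  have conv: "2 * F 0 \<le> F t + F (- t)" for t
  proof -
    have "2 * F 0 = (\<integral>\<^sup>+x. 2 * (ennreal (?g x) * indicator U x) \<partial>lborel)"
      unfolding F by (subst nn_integral_cmult) auto
    also have "\<dots> \<le> (\<integral>\<^sup>+x. ennreal (?g (t *\<^sub>R w + x)) * indicator U x + ennreal (?g ((- t) *\<^sub>R w + x)) * indicator U x \<partial>lborel)"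
    proof (rule nn_integral_mono)
      fix x :: "real^'n"
      define a where "a = t * (\<nu> \<bullet> w + 2 * (x \<bullet> (\<Theta> *v w)))"
      define b where "b = t\<^sup>2 * (w \<bullet> (\<Theta> *v w))"
      have b: "exp (- b) \<ge> 1" using wq by (simp add: b_def mult_nonneg_nonpos)
      have "?g (t *\<^sub>R w + x) = exp (- b) * exp (- a) * ?g x"
        "?g ((- t) *\<^sub>R w + x) = exp (- b) * exp a * ?g x"
        unfolding log_density_add[OF S]
        by (simp_all add: a_def b_def matrix_vector_mult_scaleR power2_eq_square algebra_simps
            flip: exp_add del: scaleR_minus_left)
      then have "?g (t *\<^sub>R w + x) + ?g ((- t) *\<^sub>R w + x) = exp (- b) * (2 * cosh a) * ?g x"
        by (simp add: cosh_def algebra_simps)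
      also have "\<dots> \<ge> 1 * (2 * 1) * ?g x"
        using b log_density_pos[of \<nu> \<Theta> x] cosh_real_ge_1[of a]
        by (intro mult_mono mult_nonneg_nonneg) auto
      finally have "2 * ?g x \<le> ?g (t *\<^sub>R w + x) + ?g ((- t) *\<^sub>R w + x)" by simp
      then have "ennreal (2 * ?g x) \<le> ennreal (?g (t *\<^sub>R w + x)) + ennreal (?g ((- t) *\<^sub>R w + x))"
        using log_density_pos[of \<nu> \<Theta>] by (subst ennreal_plus[symmetric]) (auto intro: less_imp_le ennreal_leI)
      then show "2 * (ennreal (?g x) * indicator U x) \<le>
          ennreal (?g (t *\<^sub>R w + x)) * indicator U x + ennreal (?g ((- t) *\<^sub>R w + x)) * indicator U x"
        by (simp add: indicator_def ennreal_mult')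
    qed
    also have "\<dots> = F t + F (- t)"
      unfolding F by (subst nn_integral_add) auto
    finally show ?thesis .
  qed
  have bound: "of_nat (Suc N) * F 0 \<le> ?N" for N
  proof -
    let ?I = "{- int N..int N}"
    let ?V = "\<lambda>m::int. {x. - (real_of_int m *\<^sub>R w) + x \<in> U}"
    have disj: "disjoint_family_on ?V ?I"
      unfolding disjoint_family_on_def
    proof (intro ballI impI)
      fix m m' :: int assume "m \<noteq> m'"
      show "?V m \<inter> ?V m' = {}"
      proof (rule ccontr)
        assume "?V m \<inter> ?V m' \<noteq> {}"
        then obtain x where "- (real_of_int m *\<^sub>R w) + x \<in> U" "- (real_of_int m' *\<^sub>R w) + x \<in> U" by blast
        then have "0 < x $ p - m \<and> x $ p - m < 1 \<and> 0 < x $ p - m' \<and> x $ p - m' < 1"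
          unfolding U by (auto dest!: spec[of _ p] simp: wp)
        then show False using \<open>m \<noteq> m'\<close> by linarith
      qed
    qed
    have sub: "(\<Union>m\<in>?I. ?V m) \<subseteq> log_domain"
    proof
      fix x assume "x \<in> (\<Union>m\<in>?I. ?V m)"
      then obtain m where "- (real_of_int m *\<^sub>R w) + x \<in> U" by blast
      then have m: "0 < x $ i - m * w $ i" for i unfolding U by (auto dest: spec[of _ i])
      \<comment> \<open>For \<open>m \<ge> 0\<close> the coordinate \<open>p\<close> stays positive,
        and for negative \<open>m\<close> the coordinate \<open>n\<close> does, since
        \<open>w $ n < 0\<close>.\<close>
      have "0 < x $ (if m \<ge> 0 then p else n)"
      proof (cases "m \<ge> 0")
        case True then show ?thesis using m[of p] wp by simp
      next
        case False
        then have "real_of_int m * w $ n \<ge> 0" using wn by (intro mult_nonpos_nonpos) auto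
        then show ?thesis using m[of n] False by simp
      qed
      then show "x \<in> log_domain" by blast
    qed
    have refl: "(\<Sum>m\<in>?I. F (- real_of_int m)) = (\<Sum>m\<in>?I. F (real_of_int m))"
      by (rule sum.reindex_bij_witness[of _ uminus uminus]) auto
    \<comment> \<open>The symmetric range contains \<open>2 * N + 1\<close> integers; the weaker
      count \<open>Suc N\<close> suffices for unboundedness.\<close>
    have "2 * (of_nat (Suc N) * F 0) \<le> of_nat (2 * N + 1) * (2 * F 0)"
    proof -
      have "of_nat (Suc N) \<le> (of_nat (2 * N + 1) :: ennreal)" by (subst of_nat_le_iff) simp
      then have "of_nat (Suc N) * (2 * F 0) \<le> of_nat (2 * N + 1) * (2 * F 0)"
        by (intro mult_right_mono) simp_all
      then show ?thesis by (simp only: mult.left_commute[of 2])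
    qed
    also have "\<dots> = (\<Sum>m\<in>?I. 2 * F 0)" by (simp add: nat_add_distrib nat_mult_distrib)
    also have "\<dots> \<le> (\<Sum>m\<in>?I. F (real_of_int m) + F (- real_of_int m))"
      by (intro sum_mono conv)
    also have "\<dots> = 2 * (\<Sum>m\<in>?I. F (real_of_int m))" by (simp add: sum.distrib refl mult_2)
    also have "(\<Sum>m\<in>?I. F (real_of_int m)) =
        (\<integral>\<^sup>+x. (\<Sum>m\<in>?I. ennreal (?g x) * indicator U (- (real_of_int m *\<^sub>R w) + x)) \<partial>lborel)"
      unfolding F_def by (subst nn_integral_sum) auto
    also have "\<dots> \<le> ?N"
    proof (rule nn_integral_mono)
      fix x
      have "(\<Sum>m\<in>?I. indicator U (- (real_of_int m *\<^sub>R w) + x)) = (\<Sum>m\<in>?I. indicator (?V m) x :: ennreal)"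
        by (simp add: indicator_def)
      also have "\<dots> = indicator (\<Union>m\<in>?I. ?V m) x"
        by (rule indicator_UN_disjoint[OF _ disj, symmetric]) simp
      also have "\<dots> \<le> indicator log_domain x" using sub by (auto simp: indicator_def)
      finally show "(\<Sum>m\<in>?I. ennreal (?g x) * indicator U (- (real_of_int m *\<^sub>R w) + x)) \<le> ennreal (?g x) * indicator log_domain x"
        by (simp add: sum_distrib_left[symmetric] mult_left_mono)
    qed
    finally have "2 * (of_nat (Suc N) * F 0) \<le> 2 * ?N" by (simp add: mult_left_mono)
    then show ?thesis by (subst (asm) ennreal_mult_le_mult_iff) simp_all
  qed
  obtain r where r: "?N = ennreal r" "r \<ge> 0" using fin by (cases ?N) auto
  have "F 0 \<le> ?N" using bound[of 0] by simp
  then obtain f where f: "F 0 = ennreal f" "f > 0" using F0 r(1)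
    by (cases "F 0") (auto simp: ennreal_less_zero_iff top_unique)
  have "real (Suc N) * f \<le> r" for N
    using bound[of N] f r by (simp add: ennreal_of_nat_eq_real_of_nat ennreal_mult''[symmetric] ennreal_le_iff del: of_nat_Suc)
  obtain N where "r / f < real N" using reals_Archimedean2 by blast
  then have "r < real N * f" using f(2) by (simp add: divide_less_eq)
  also have "\<dots> \<le> real (Suc N) * f" using f(2) by (simp add: mult_right_mono)
  also have "\<dots> \<le> r" by fact
  finally show False by simp
qed

section \<open>Exponential decay\<close>

text \<open>The slice \<open>z $ k = 0\<close> meets the line through \<open>1\<close> only at 0, so
  the form is positive on it away from 0. Compactness of its unit sphere gives the constant, and
  homogeneity extends the bound.\<close>

lemma quadratic_lower_bound:
  fixes \<Theta> :: "real^'n^'n"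
  assumes "\<Theta> \<in> sym_kernel_one_pos"
  obtains c where "c > 0" "\<And>z. z $ k = 0 \<Longrightarrow> c * (norm z)\<^sup>2 \<le> z \<bullet> (\<Theta> *v z)"
proof -
  have S: "\<Theta> \<in> sym_kernel_one" using assms by (simp add: sym_kernel_one_pos_def)
  let ?K = "{z::real^'n. norm z = 1 \<and> z $ k = 0}"
  have pos: "0 < z \<bullet> (\<Theta> *v z)" if "z \<in> ?K" for z
  proof -
    have "centre z \<noteq> 0"
    proof
      assume "centre z = 0"
      then have "z = (z \<bullet> 1 / real CARD('n)) *\<^sub>R 1" by (simp add: centre_def)
      then obtain a where "z = a *\<^sub>R 1" by blast
      then show False using that by auto
    qed
    then show ?thesis
      using assms sym_kernel_one_pos_iff[OF S] centre_inner_one quadratic_centre[OF S, of z] by metis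
  qed
  have compact: "compact ?K"
  proof -
    have "?K = sphere 0 1 \<inter> {z. z $ k = 0}" by (auto simp: dist_norm)
    moreover have "closed {z::real^'n. z $ k = 0}"
      by (intro closed_Collect_eq continuous_intros)
    ultimately show ?thesis by (simp add: compact_Int_closed)
  qed
  have cont: "continuous_on ?K (\<lambda>z. z \<bullet> (\<Theta> *v z))"
    by (intro continuous_intros matrix_vector_mult_linear_continuous_on)
  have "\<exists>c>0. \<forall>z\<in>?K. c \<le> z \<bullet> (\<Theta> *v z)"
  proof (cases "?K = {}")
    \<comment> \<open>This is dimension one, where the slice contains only 0.\<close>
    case True
    show ?thesis unfolding True by (rule exI[of _ 1]) simp
  next
    case False
    obtain z where z: "z \<in> ?K" "\<forall>y\<in>?K. z \<bullet> (\<Theta> *v z) \<le> y \<bullet> (\<Theta> *v y)"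
      using continuous_attains_inf[OF compact False cont] by (elim bexE)
    show ?thesis using pos[OF z(1)] z(2) by (intro exI conjI)
  qed
  then obtain c where "c > 0" and K: "\<forall>z\<in>?K. c \<le> z \<bullet> (\<Theta> *v z)" by (elim exE conjE)
  note c = \<open>c > 0\<close> K[rule_format]
  show ?thesis
  proof (rule that[OF c(1)])
    fix z :: "real^'n" assume z: "z $ k = 0"
    show "c * (norm z)\<^sup>2 \<le> z \<bullet> (\<Theta> *v z)"
    proof (cases "z = 0")
      case False
      then have "c \<le> (z /\<^sub>R norm z) \<bullet> (\<Theta> *v (z /\<^sub>R norm z))" using z by (intro c(2)) simp
      also have "\<dots> = (z \<bullet> (\<Theta> *v z)) / (norm z)\<^sup>2"
        by (simp add: matrix_vector_mult_scaleR power2_eq_square divide_inverse)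
      finally show ?thesis using False by (simp add: le_divide_eq)
    qed simp
  qed
qed

text \<open>Split \<open>x\<close> into its part along \<open>1\<close> and a remainder
  \<open>z\<close> with \<open>z $ k = 0\<close>. The drift gives exponential decay in
  \<open>x $ k\<close>, while the quadratic form dominates every linear term in \<open>z\<close>.
  The product form of the bound lets its integral factorise.\<close>

lemma log_density_le_exp:
  fixes \<nu> :: "real^'n"
  assumes Pos: "\<Theta> \<in> sym_kernel_one_pos" and drift: "\<nu> \<bullet> 1 > 0"
  obtains K \<epsilon> where "\<epsilon> > 0" "\<And>x. 0 < x $ k \<Longrightarrow>
    log_density \<nu> \<Theta> x \<le> exp K * (\<Prod>i\<in>UNIV. exp (- \<epsilon> * \<bar>x $ i\<bar>))"
proof -
  have S: "\<Theta> \<in> sym_kernel_one" using Pos by (simp add: sym_kernel_one_pos_def)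
  obtain c where c: "c > 0" "\<And>z. z $ k = 0 \<Longrightarrow> c * (norm z)\<^sup>2 \<le> z \<bullet> (\<Theta> *v z)"
    using quadratic_lower_bound[OF Pos] by blast
  define d where "d = real CARD('n)"
  have d: "d > 0" by (simp add: d_def)
  \<comment> \<open>This collects the linear terms: \<open>norm \<nu>\<close> bounds the drift along
    \<open>z\<close>, and \<open>d\<close> compares the sum of the |z_i| with the norm of
    \<open>z\<close>.\<close>
  define L where "L = norm \<nu> + d"
  \<comment> \<open>The second bound lets the drift pay for the d copies of \<open>x $ k\<close>;
    the bound 1 controls the part in \<open>z\<close>.\<close>
  define \<epsilon> where "\<epsilon> = min 1 (\<nu> \<bullet> 1 / d)"
  have \<epsilon>: "0 < \<epsilon>" "\<epsilon> \<le> 1" "\<epsilon> * d \<le> \<nu> \<bullet> 1"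
    using drift d by (auto simp: \<epsilon>_def min_def field_simps)
  show ?thesis
  proof (rule that[OF \<epsilon>(1)])
    fix x :: "real^'n" assume xk: "0 < x $ k"
    define z where "z = x - (x $ k) *\<^sub>R 1"
    have x: "x = (x $ k) *\<^sub>R 1 + z" by (simp add: z_def)
    let ?Z = "\<Sum>i\<in>UNIV. \<bar>z $ i\<bar>" and ?X = "\<Sum>i\<in>UNIV. \<bar>x $ i\<bar>"
    have Z: "?Z \<le> d * norm z"
      unfolding d_def by (rule sum_bounded_above[where K = "norm z", THEN order_trans])
        (auto intro: component_le_norm_cart)
    have "?X \<le> (\<Sum>i\<in>UNIV. x $ k + \<bar>z $ i\<bar>)"
      using xk by (intro sum_mono) (simp add: z_def)
    also have "\<dots> = d * x $ k + ?Z" by (simp add: sum.distrib d_def)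
    finally have "\<epsilon> * ?X \<le> \<epsilon> * (d * x $ k + ?Z)" using \<epsilon>(1) by (simp add: mult_left_mono)
    also have "\<dots> = (\<epsilon> * d) * x $ k + \<epsilon> * ?Z" by (simp add: algebra_simps)
    also have "\<dots> \<le> (\<nu> \<bullet> 1) * x $ k + 1 * ?Z"
      using \<epsilon> xk by (intro add_mono mult_right_mono) (auto intro: sum_nonneg)
    finally have X: "\<epsilon> * ?X \<le> (\<nu> \<bullet> 1) * x $ k + ?Z" by simp
    have "- (\<nu> \<bullet> z) - z \<bullet> (\<Theta> *v z) + ?Z \<le> norm \<nu> * norm z - c * (norm z)\<^sup>2 + d * norm z"
      using Cauchy_Schwarz_ineq2[of \<nu> z] c(2)[of z] Z by (simp add: z_def)
    \<comment> \<open>Completing the square bounds the expression independently of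
      \<open>z\<close>.\<close>
    also have "\<dots> = L\<^sup>2 / (4 * c) - c * (norm z - L / (2 * c))\<^sup>2"
      using c(1) by (simp add: L_def power2_eq_square field_simps)
    also have "\<dots> \<le> L\<^sup>2 / (4 * c)" using c(1) by simp
    finally have "- (\<nu> \<bullet> z) - z \<bullet> (\<Theta> *v z) + ?Z \<le> L\<^sup>2 / (4 * c)" .
    then have "- (\<nu> \<bullet> 1) * x $ k + (- (\<nu> \<bullet> z) - z \<bullet> (\<Theta> *v z)) \<le> L\<^sup>2 / (4 * c) + (- \<epsilon> * ?X)"
      using X by simp
    then have "exp (- (\<nu> \<bullet> 1) * x $ k + (- (\<nu> \<bullet> z) - z \<bullet> (\<Theta> *v z))) \<le>
        exp (L\<^sup>2 / (4 * c) + (- \<epsilon> * ?X))" by simp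
    moreover have "log_density \<nu> \<Theta> x = exp (- (\<nu> \<bullet> 1) * x $ k + (- (\<nu> \<bullet> z) - z \<bullet> (\<Theta> *v z)))"
    proof -
      have "log_density \<nu> \<Theta> x = log_density \<nu> \<Theta> ((x $ k) *\<^sub>R 1 + z)" using x by simp
      also have "\<dots> = exp (- (x $ k) * (\<nu> \<bullet> 1)) * log_density \<nu> \<Theta> z"
        by (rule log_density_shift_one[OF S])
      finally show ?thesis by (simp add: log_density_def mult.commute flip: exp_add)
    qed
    moreover have "(\<Prod>i\<in>UNIV. exp (- \<epsilon> * \<bar>x $ i\<bar>)) = exp (- \<epsilon> * ?X)"
      by (simp add: exp_sum[symmetric] sum_distrib_left sum_negf)
    ultimately show "log_density \<nu> \<Theta> x \<le> exp (L\<^sup>2 / (4 * c)) * (\<Prod>i\<in>UNIV. exp (- \<epsilon> * \<bar>x $ i\<bar>))"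
      by (simp only: exp_add)
  qed
qed

lemma nn_integral_exp_tail:
  assumes "\<epsilon> > 0"
  shows "(\<integral>\<^sup>+t. ennreal (exp (- \<epsilon> * t)) * indicator {0..} t \<partial>lborel) = ennreal (1 / \<epsilon>)"
proof -
  have "(\<integral>\<^sup>+t. ennreal (exp (- \<epsilon> * t)) * indicator {0..} t \<partial>lborel) =
      ennreal (0 - (- exp (- \<epsilon> * 0) / \<epsilon>))"
  proof (rule nn_integral_FTC_atLeast)
    show "((\<lambda>t. - exp (- \<epsilon> * t) / \<epsilon>) \<longlongrightarrow> 0) at_top"
      using assms by real_asymp
  qed (use assms in \<open>auto intro!: derivative_eq_intros\<close>)
  then show ?thesis by simp
qed

lemma nn_integral_exp_abs_finite:
  assumes "\<epsilon> > 0"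
  shows "(\<integral>\<^sup>+t. ennreal (exp (- \<epsilon> * \<bar>t\<bar>)) \<partial>lborel) < \<infinity>"
proof -
  let ?f = "\<lambda>t. ennreal (exp (- \<epsilon> * t)) * indicator {0..} t"
  have "(\<integral>\<^sup>+t. ennreal (exp (- \<epsilon> * \<bar>t\<bar>)) \<partial>lborel) \<le> (\<integral>\<^sup>+t. ?f t + ?f (- t) \<partial>lborel)"
    by (intro nn_integral_mono) (auto simp: indicator_def abs_if)
  also have "\<dots> = (\<integral>\<^sup>+t. ?f t \<partial>lborel) + (\<integral>\<^sup>+t. ?f (- t) \<partial>lborel)"
    by (rule nn_integral_add) auto
  also have "(\<integral>\<^sup>+t. ?f (- t) \<partial>lborel) = (\<integral>\<^sup>+t. ?f t \<partial>lborel)"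
    by (subst (2) nn_integral_real_affine[of _ "-1" 0]) auto
  finally show ?thesis
    unfolding nn_integral_exp_tail[OF assms] by (simp add: order_le_less_trans)
qed

text \<open>The domain is the union of the d halfspaces \<open>log_halfspace k\<close>, and on each
  of them the product bound is integrable.\<close>

lemma log_density_integrable:
  fixes \<nu> :: "real^'n"
  assumes Pos: "\<Theta> \<in> sym_kernel_one_pos" and drift: "\<nu> \<bullet> 1 > 0"
  shows "(\<integral>\<^sup>+x. ennreal (log_density \<nu> \<Theta> x) * indicator log_domain x \<partial>lborel) < \<infinity>"
proof -
  let ?g = "log_density \<nu> \<Theta>"
  have half: "(\<integral>\<^sup>+x. ennreal (?g x) * indicator (log_halfspace k) x \<partial>lborel) < \<infinity>" for k
  proof -
    obtain K \<epsilon> where \<epsilon>: "\<epsilon> > 0" and K: "\<And>x. 0 < x $ k \<Longrightarrow>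
        ?g x \<le> exp K * (\<Prod>i\<in>UNIV. exp (- \<epsilon> * \<bar>x $ i\<bar>))"
      using log_density_le_exp[OF assms] by blast
    have "(\<integral>\<^sup>+x. ennreal (?g x) * indicator (log_halfspace k) x \<partial>lborel) \<le>
        (\<integral>\<^sup>+(x::real^'n). ennreal (exp K) * (\<Prod>b\<in>Basis. ennreal (exp (- \<epsilon> * \<bar>x \<bullet> b\<bar>))) \<partial>lborel)"
    proof (rule nn_integral_mono)
      fix x :: "real^'n"
      have eq: "ennreal (exp K) * (\<Prod>b\<in>Basis. ennreal (exp (- \<epsilon> * \<bar>x \<bullet> b\<bar>))) =
          ennreal (exp K * (\<Prod>i\<in>UNIV. exp (- \<epsilon> * \<bar>x $ i\<bar>)))"
        by (simp add: prod_Basis_vec inner_axis prod_ennreal ennreal_mult prod_nonneg)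
      show "ennreal (?g x) * indicator (log_halfspace k) x \<le>
          ennreal (exp K) * (\<Prod>b\<in>Basis. ennreal (exp (- \<epsilon> * \<bar>x \<bullet> b\<bar>)))"
        unfolding eq by (cases "0 < x $ k") (use K in \<open>auto intro!: ennreal_leI\<close>)
    qed
    also have "\<dots> = ennreal (exp K) * (\<integral>\<^sup>+x. (\<Prod>b\<in>Basis. ennreal (exp (- \<epsilon> * \<bar>(x::real^'n) \<bullet> b\<bar>))) \<partial>lborel)"
      by (rule nn_integral_cmult) measurable
    also have "\<dots> = ennreal (exp K) * (\<Prod>b\<in>(Basis::(real^'n) set). (\<integral>\<^sup>+t. ennreal (exp (- \<epsilon> * \<bar>t\<bar>)) \<partial>lborel))"
      by (subst nn_integral_lborel_prod) auto
    also have "\<dots> < \<infinity>"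
      using nn_integral_exp_abs_finite[OF \<epsilon>]
      by (simp add: ennreal_mult_less_top power_less_top_ennreal)
    finally show ?thesis .
  qed
  have "(\<integral>\<^sup>+x. ennreal (?g x) * indicator log_domain x \<partial>lborel) \<le>
      (\<integral>\<^sup>+x. (\<Sum>k\<in>UNIV. ennreal (?g x) * indicator (log_halfspace k) x) \<partial>lborel)"
  proof (rule nn_integral_mono)
    fix x :: "real^'n"
    show "ennreal (?g x) * indicator log_domain x \<le>
        (\<Sum>k\<in>UNIV. ennreal (?g x) * indicator (log_halfspace k) x)"
    proof (cases "x \<in> log_domain")
      case True
      then obtain k where "0 < x $ k" by blast
      then have "ennreal (?g x) * indicator log_domain x \<le> ennreal (?g x) * indicator (log_halfspace k) x"
        by (simp add: indicator_def)
      also have "\<dots> \<le> (\<Sum>k\<in>UNIV. ennreal (?g x) * indicator (log_halfspace k) x)"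
        by (rule member_le_sum) auto
      finally show ?thesis .
    qed simp
  qed
  also have "\<dots> = (\<Sum>k\<in>UNIV. (\<integral>\<^sup>+x. ennreal (?g x) * indicator (log_halfspace k) x \<partial>lborel))"
    by (subst nn_integral_sum) auto
  also have "\<dots> < \<infinity>" using half by simp
  finally show ?thesis .
qed

section \<open>Comparison of the marginal probabilities\<close>

text \<open>The slab has length 1 in the direction \<open>1\<close>, so its indicator along the line
  through \<open>x\<close> integrates to 1 and can be inserted. Exchanging the integrals and
  translating moves the halfspace condition to \<open>s < x $ j\<close> with density factor
  \<open>exp s\<close>, whose integral is \<open>exp (x $ j)\<close>. Afterwards the region of
  integration is the same for every \<open>j\<close>.\<close>

lemma marginal_eq_slab_integral:
  fixes \<nu> :: "real^'n"
  assumes S: "\<Theta> \<in> sym_kernel_one" and "\<nu> \<bullet> 1 = 1"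
  shows "(\<integral>\<^sup>+x. ennreal (log_density \<nu> \<Theta> x) * indicator (log_halfspace j) x \<partial>lborel) =
    (\<integral>\<^sup>+x. ennreal (exp (x $ j) * log_density \<nu> \<Theta> x) * indicator {x. 0 < x $ k \<and> x $ k < 1} x \<partial>lborel)"
proof -
  let ?g = "log_density \<nu> \<Theta>"
  let ?Q = "{x::real^'n. 0 < x $ k \<and> x $ k < 1}"
  define F where "F x s = ennreal (?g x) * indicator (log_halfspace j) x * indicator ?Q (s *\<^sub>R 1 + x)"
    for x :: "real^'n" and s :: real
  have F: "F x s = (if 0 < x $ j \<and> 0 < s + x $ k \<and> s + x $ k < 1 then ennreal (?g x) else 0)" for x s
    by (simp add: F_def indicator_def)
  have [measurable]: "(\<lambda>(x, s). F x s) \<in> borel_measurable (lborel \<Otimes>\<^sub>M lborel)"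
    unfolding F by measurable
  have "(\<integral>\<^sup>+x. ennreal (?g x) * indicator (log_halfspace j) x \<partial>lborel) =
      (\<integral>\<^sup>+x. (\<integral>\<^sup>+s. F x s \<partial>lborel) \<partial>lborel)"
  proof (rule nn_integral_cong)
    fix x :: "real^'n"
    have "F x s = ennreal (?g x) * indicator (log_halfspace j) x * indicator {- x $ k<..<1 - x $ k} s" for s
      by (auto simp: F indicator_def)
    then show "ennreal (?g x) * indicator (log_halfspace j) x = (\<integral>\<^sup>+s. F x s \<partial>lborel)"
      by (simp add: nn_integral_cmult)
  qed
  also have "\<dots> = (\<integral>\<^sup>+s. (\<integral>\<^sup>+x. F x s \<partial>lborel) \<partial>lborel)"
    by (rule lborel_pair.Fubini') measurable
  \<comment> \<open>After this translation the slab condition no longer involves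
    \<open>s\<close>.\<close>
  also have "\<dots> = (\<integral>\<^sup>+s. (\<integral>\<^sup>+x. F ((- s) *\<^sub>R 1 + x) s \<partial>lborel) \<partial>lborel)"
    by (intro nn_integral_cong nn_integral_lborel_translate[symmetric]) measurable
  also have "\<dots> = (\<integral>\<^sup>+x. (\<integral>\<^sup>+s. F ((- s) *\<^sub>R 1 + x) s \<partial>lborel) \<partial>lborel)"
    by (rule lborel_pair.Fubini'[symmetric]) (unfold F, measurable)
  also have "\<dots> = (\<integral>\<^sup>+x. ennreal (exp (x $ j) * ?g x) * indicator ?Q x \<partial>lborel)"
  proof (rule nn_integral_cong)
    fix x :: "real^'n"
    have shift: "?g (x - s *\<^sub>R 1) = exp s * ?g x" for s
      using log_density_shift_one[OF S, of \<nu> "- s" x] assms(2) by simp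
    have "(\<integral>\<^sup>+s. F ((- s) *\<^sub>R 1 + x) s \<partial>lborel) =
        (\<integral>\<^sup>+s. ennreal (?g x) * indicator ?Q x * (ennreal (exp s) * indicator {..<x $ j} s) \<partial>lborel)"
      by (intro nn_integral_cong) (auto simp: F indicator_def shift ennreal_mult' mult.commute)
    also have "\<dots> = ennreal (?g x) * indicator ?Q x * (\<integral>\<^sup>+s. ennreal (exp s) * indicator {..<x $ j} s \<partial>lborel)"
      by (rule nn_integral_cmult) auto
    also have "(\<integral>\<^sup>+s. ennreal (exp s) * indicator {..<x $ j} s \<partial>lborel) = ennreal (exp (x $ j))"
    proof -
      have "(\<integral>\<^sup>+s. ennreal (exp s) * indicator {..<x $ j} s \<partial>lborel) =
          (\<integral>\<^sup>+t. ennreal (exp (x $ j - t)) * indicator {..<x $ j} (x $ j - t) \<partial>lborel)"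
        by (subst nn_integral_real_affine[of _ "-1" "x $ j"]) auto
      also have "\<dots> = (\<integral>\<^sup>+t. ennreal (exp (x $ j)) * (ennreal (exp (- 1 * t)) * indicator {0..} t) \<partial>lborel)"
      proof (rule nn_integral_cong_AE)
        show "AE t in lborel. ennreal (exp (x $ j - t)) * indicator {..<x $ j} (x $ j - t) =
            ennreal (exp (x $ j)) * (ennreal (exp (- 1 * t)) * indicator {0..} t)"
          using AE_lborel_singleton[of "0::real"]
          by eventually_elim (auto simp: indicator_def ennreal_mult[symmetric] exp_add[symmetric])
      qed
      also have "\<dots> = ennreal (exp (x $ j)) * ennreal (1 / 1)"
        by (subst nn_integral_cmult) (simp_all only: nn_integral_exp_tail, measurable)
      finally show ?thesis by simp
    qed
    finally show "(\<integral>\<^sup>+s. F ((- s) *\<^sub>R 1 + x) s \<partial>lborel) = ennreal (exp (x $ j) * ?g x) * indicator ?Q x"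
      by (simp add: ennreal_mult log_density_pos less_imp_le mult_ac)
  qed
  finally show ?thesis .
qed

text \<open>Both marginals become integrals over the same slab, weighted by
  \<open>exp (x $ j)\<close> and \<open>exp (x $ k)\<close>. A translation by \<open>w\<close> that
  preserves the slab has cross term \<open>x $ j - x $ k\<close>, which exchanges the two weights up
  to a constant factor.\<close>

lemma marginal_ratio:
  fixes \<nu> :: "real^'n"
  assumes Pos: "\<Theta> \<in> sym_kernel_one_pos" and \<nu>: "\<nu> \<bullet> 1 = 1"
  defines "u \<equiv> pinv \<Theta> *v \<nu> - (1/2) *\<^sub>R diag_vec (pinv \<Theta>)"
  shows "(\<integral>\<^sup>+x. ennreal (log_density \<nu> \<Theta> x) * indicator (log_halfspace j) x \<partial>lborel) =
    ennreal (exp ((u $ k - u $ j) / 2)) *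
    (\<integral>\<^sup>+x. ennreal (log_density \<nu> \<Theta> x) * indicator (log_halfspace k) x \<partial>lborel)"
proof -
  have S: "\<Theta> \<in> sym_kernel_one" using Pos by (simp add: sym_kernel_one_pos_def)
  note B = pinv_sym_kernel_one_pos[OF Pos]
  let ?g = "log_density \<nu> \<Theta>"
  let ?Q = "{x::real^'n. 0 < x $ k \<and> x $ k < 1}"
  define e :: "real^'n" where "e = axis j 1 - axis k 1"
  have e: "x \<bullet> e = x $ j - x $ k" for x by (simp add: e_def inner_diff_right inner_axis)
  define b where "b = pinv \<Theta> *v e"
  have "e \<bullet> 1 = 0" using e[of 1] by (simp add: inner_commute)
  then have Tb: "\<Theta> *v b = e" by (simp add: b_def B centre_def)
  have bi: "b $ i = pinv \<Theta> $ i $ j - pinv \<Theta> $ i $ k" for i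
    by (simp add: b_def e_def matrix_vector_mult_diff_distrib matrix_vector_mult_basis column_def)
  have Bjk: "pinv \<Theta> $ k $ j = pinv \<Theta> $ j $ k"
    using arg_cong[OF B(1), of "\<lambda>A. A $ j $ k"] by (simp add: transpose_def)
  \<comment> \<open>Subtracting a multiple of \<open>1\<close> makes \<open>w $ k\<close> vanish, so
    the slab is preserved, and leaves \<open>\<Theta> *v w\<close> unchanged.\<close>
  define w where "w = (1/2) *\<^sub>R b - (b $ k / 2) *\<^sub>R 1"
  have wk: "w $ k = 0" by (simp add: w_def)
  have Tw: "\<Theta> *v w = (1/2) *\<^sub>R e"
    by (simp add: w_def matrix_vector_mult_diff_distrib matrix_vector_mult_scaleR Tb sym_kernel_oneD(2)[OF S])
  have "\<nu> \<bullet> b = (pinv \<Theta> *v \<nu>) $ j - (pinv \<Theta> *v \<nu>) $ k"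
    unfolding b_def symmetric_inner_commute[OF B(1)] e ..
  \<comment> \<open>The off-diagonal entries of the pseudoinverse cancel by symmetry, and
    \<open>\<nu> \<bullet> 1 = 1\<close> evaluates the correction along \<open>1\<close>. Only
    diagonal entries and \<open>pinv \<Theta> *v \<nu>\<close> survive, which explains the form of
    \<open>u\<close>.\<close>
  then have expo: "w $ j / 2 - \<nu> \<bullet> w = (u $ k - u $ j) / 2"
    by (simp add: u_def w_def bi Bjk inner_diff_right \<nu> diag_vec_def field_simps)
  have shift: "exp ((w + x) $ j) * ?g (w + x) = exp ((u $ k - u $ j) / 2) * (exp (x $ k) * ?g x)" for x
  proof -
    have "w \<bullet> (\<Theta> *v w) = w $ j / 2" by (simp add: Tw e wk)
    moreover have "2 * (x \<bullet> (\<Theta> *v w)) = x $ j - x $ k" by (simp add: Tw e)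
    ultimately have "exp ((w + x) $ j) * ?g (w + x) =
        exp (w $ j + x $ j + (- (\<nu> \<bullet> w) - w $ j / 2 - (x $ j - x $ k))) * ?g x"
      unfolding log_density_add[OF S] vector_add_component mult.assoc[symmetric] exp_add[symmetric]
      by (simp only:)
    also have "w $ j + x $ j + (- (\<nu> \<bullet> w) - w $ j / 2 - (x $ j - x $ k)) = (u $ k - u $ j) / 2 + x $ k"
      using expo by simp
    finally show ?thesis by (simp add: exp_add)
  qed
  have "(\<integral>\<^sup>+x. ennreal (?g x) * indicator (log_halfspace j) x \<partial>lborel) =
      (\<integral>\<^sup>+x. ennreal (exp (x $ j) * ?g x) * indicator ?Q x \<partial>lborel)"
    by (rule marginal_eq_slab_integral[OF S \<nu>])
  also have "\<dots> = (\<integral>\<^sup>+x. ennreal (exp ((w + x) $ j) * ?g (w + x)) * indicator ?Q (w + x) \<partial>lborel)"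
    by (rule nn_integral_lborel_translate[symmetric]) measurable
  also have "\<dots> = (\<integral>\<^sup>+x. ennreal (exp ((u $ k - u $ j) / 2)) * (ennreal (exp (x $ k) * ?g x) * indicator ?Q x) \<partial>lborel)"
    unfolding shift by (intro nn_integral_cong) (simp add: indicator_def wk ennreal_mult')
  also have "\<dots> = ennreal (exp ((u $ k - u $ j) / 2)) * (\<integral>\<^sup>+x. ennreal (exp (x $ k) * ?g x) * indicator ?Q x \<partial>lborel)"
    by (rule nn_integral_cmult) measurable
  also have "(\<integral>\<^sup>+x. ennreal (exp (x $ k) * ?g x) * indicator ?Q x \<partial>lborel) =
      (\<integral>\<^sup>+x. ennreal (?g x) * indicator (log_halfspace k) x \<partial>lborel)"
    by (rule marginal_eq_slab_integral[OF S \<nu>, symmetric])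
  finally show ?thesis .
qed

section \<open>Pareto and Huesler--Reiss densities\<close>

text \<open>A dilation multiplies Lebesgue measure by a nonzero constant, so null sets are
  preserved.\<close>

lemma AE_lborel_scaleR:
  assumes "AE x in lborel. P x" "c \<noteq> 0"
    and [measurable]: "Measurable.pred borel P"
  shows "AE x in lborel. P (c *\<^sub>R (x :: 'a::euclidean_space))"
proof -
  have "AE x in density (distr lborel borel (\<lambda>x::'a. 0 + c *\<^sub>R x)) (\<lambda>_. ennreal (\<bar>c\<bar> ^ DIM('a))). P x"
    using assms(1) unfolding lborel_affine[OF assms(2), of 0, symmetric] .
  then show ?thesis
    using assms(2) by (simp add: AE_density AE_distr_iff)
qed

lemma gen_HR_exp_eq: "gen_HR_exp \<mu> \<Theta> y = log_density \<mu> \<Theta> (ln_vec y)"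
  by (simp add: gen_HR_exp_def log_density_def)

lemma gen_HR_exp_pos: "0 < gen_HR_exp \<mu> \<Theta> y"
  by (simp add: gen_HR_exp_def)

text \<open>Scaling by \<open>t\<close> is translation by \<open>ln t\<close> along \<open>1\<close>
  in logarithmic coordinates.\<close>

lemma gen_HR_exp_scaleR:
  assumes "\<Theta> \<in> sym_kernel_one" "0 < t" "\<And>i. 0 < y $ i"
  shows "gen_HR_exp \<mu> \<Theta> (t *\<^sub>R y) = t powr (- (\<mu> \<bullet> 1)) * gen_HR_exp \<mu> \<Theta> y"
proof -
  have "ln_vec (t *\<^sub>R y) = ln t *\<^sub>R 1 + ln_vec y"
    using assms(2,3) by (simp add: ln_vec_def vec_eq_iff ln_mult_pos)
  then show ?thesis
    using assms(2) by (simp add: gen_HR_exp_eq log_density_shift_one[OF assms(1)] powr_def mult.commute)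
qed

lemma pareto_domain_scaleR:
  assumes "y \<in> pareto_domain" "1 \<le> t"
  shows "t *\<^sub>R y \<in> pareto_domain"
proof -
  obtain i where i: "1 < y $ i" using assms(1) by (auto simp: mem_pareto_domain)
  have "1 * 1 < t * y $ i" using i assms(2) by (intro mult_le_less_imp_less) auto
  then show ?thesis using assms by (auto simp: mem_pareto_domain)
qed

section \<open>Integrability, normalisation and marginals\<close>

lemma measurable_gen_HR [measurable]: "gen_HR Z \<mu> \<Theta> \<in> borel_measurable borel"
  unfolding gen_HR_def[abs_def] by measurable

lemma gen_HR_nonneg: "0 < Z \<Longrightarrow> 0 \<le> gen_HR Z \<mu> \<Theta> y"
  by (simp add: gen_HR_def less_imp_le[OF gen_HR_exp_pos])

lemma set_integrable_gen_HR_iff: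
  assumes "Z \<noteq> 0"
  shows "set_integrable lborel pareto_domain (gen_HR Z \<mu> \<Theta>) \<longleftrightarrow>
    set_integrable lborel pareto_domain (gen_HR_exp \<mu> \<Theta>)"
proof -
  have "set_integrable lborel pareto_domain (gen_HR Z \<mu> \<Theta>) \<longleftrightarrow>
      set_integrable lborel pareto_domain (\<lambda>y. (1 / Z) * gen_HR_exp \<mu> \<Theta> y)"
    by (rule set_integrable_cong) (auto simp: gen_HR_def)
  then show ?thesis using assms by simp
qed

lemma gen_HR_not_integrable:
  fixes \<mu> :: "real^'n"
  assumes S: "\<Theta> \<in> sym_kernel_one" and Z: "normalizing_const \<mu> \<Theta> Z"
    and "\<Theta> \<notin> sym_kernel_one_pos \<or> \<mu> \<bullet> 1 \<le> real CARD('n)"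
  shows "\<not> set_integrable lborel pareto_domain (gen_HR Z \<mu> \<Theta>)"
proof -
  have "(\<integral>\<^sup>+x. ennreal (log_density (\<mu> - 1) \<Theta> x) * indicator log_domain x \<partial>lborel) = \<infinity>"
    using assms(3)
  proof
    assume "\<Theta> \<notin> sym_kernel_one_pos"
    then obtain v where "v \<bullet> 1 = 0" "v \<noteq> 0" "v \<bullet> (\<Theta> *v v) \<le> 0"
      unfolding sym_kernel_one_pos_iff[OF S] by (auto simp: not_less)
    then show ?thesis by (rule log_density_not_integrable_direction[OF S])
  next
    assume "\<mu> \<bullet> 1 \<le> real CARD('n)"
    then show ?thesis
      by (intro log_density_not_integrable_drift S) (simp add: inner_diff_left inner_one_one)
  qed
  then have "\<not> set_integrable lborel pareto_domain (gen_HR_exp \<mu> \<Theta>)"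
    by (simp add: set_integrable_gen_HR_exp_iff)
  \<comment> \<open>Without integrability \<open>Z\<close> is the arbitrary positive constant, and
    dividing by it cannot restore integrability.\<close>
  moreover from this have "Z > 0" using Z by (simp add: normalizing_const_def)
  ultimately show ?thesis by (simp add: set_integrable_gen_HR_iff)
qed

text \<open>Here \<open>normalizing_const\<close> makes \<open>Z\<close> the actual integral, which
  is positive because the logarithmic domain contains a cube.\<close>

lemma gen_HR_integrable:
  fixes \<mu> :: "real^'n"
  assumes "\<Theta> \<in> sym_kernel_one_pos" "\<mu> \<bullet> 1 > real CARD('n)" "normalizing_const \<mu> \<Theta> Z"
  shows "0 < Z" "set_integrable lborel pareto_domain (gen_HR Z \<mu> \<Theta>)"
    and "(\<integral>\<^sup>+y. ennreal (gen_HR Z \<mu> \<Theta> y) \<partial>lborel) = 1"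
proof -
  have drift: "(\<mu> - 1) \<bullet> 1 > 0" using assms(2) by (simp add: inner_diff_left inner_one_one)
  have int: "set_integrable lborel pareto_domain (gen_HR_exp \<mu> \<Theta>)"
    unfolding set_integrable_gen_HR_exp_iff by (rule log_density_integrable[OF assms(1) drift])
  then have Z: "Z = (\<integral>y. indicator pareto_domain y * gen_HR_exp \<mu> \<Theta> y \<partial>lborel)"
    using assms(3) by (simp add: normalizing_const_def set_lebesgue_integral_def)
  let ?N = "\<integral>\<^sup>+y. ennreal (gen_HR_exp \<mu> \<Theta> y) * indicator pareto_domain y \<partial>lborel"
  have "ennreal Z = (\<integral>\<^sup>+y. ennreal (indicator pareto_domain y * gen_HR_exp \<mu> \<Theta> y) \<partial>lborel)"
    unfolding Z using int
    by (intro nn_integral_eq_integral[symmetric])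
      (auto simp: set_integrable_def less_imp_le[OF gen_HR_exp_pos])
  also have "\<dots> = ?N" by (intro nn_integral_cong) (simp add: indicator_def)
  finally have N: "ennreal Z = ?N" .
  also have "?N = (\<integral>\<^sup>+x. ennreal (log_density (\<mu> - 1) \<Theta> x) * indicator log_domain x \<partial>lborel)"
    by (rule nn_integral_gen_HR_exp) (auto simp: mem_pareto_domain ln_vec_def less_imp_le)
  also have "\<dots> > 0"
  proof (rule nn_integral_log_density_pos)
    have "0 < emeasure lborel (box 0 1 :: (real^'n) set)" by (rule emeasure_box_pos) simp
    also have "\<dots> \<le> emeasure lborel (log_domain :: (real^'n) set)"
      by (rule emeasure_mono) (auto simp: mem_box_cart)
    finally show "0 < emeasure lborel (log_domain :: (real^'n) set)" .
  qed simp
  finally show "0 < Z" by (simp add: ennreal_less_zero_iff)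
  then show "set_integrable lborel pareto_domain (gen_HR Z \<mu> \<Theta>)"
    using int by (simp add: set_integrable_gen_HR_iff)
  have "(\<integral>\<^sup>+y. ennreal (gen_HR Z \<mu> \<Theta> y) \<partial>lborel) =
      (\<integral>\<^sup>+y. ennreal (1 / Z) * (ennreal (gen_HR_exp \<mu> \<Theta> y) * indicator pareto_domain y) \<partial>lborel)"
    using \<open>0 < Z\<close> by (intro nn_integral_cong)
      (auto simp: gen_HR_def indicator_def less_imp_le[OF gen_HR_exp_pos] simp flip: ennreal_mult)
  also have "\<dots> = ennreal (1 / Z) * ?N" by (rule nn_integral_cmult) measurable
  also have "\<dots> = 1" using \<open>0 < Z\<close> by (simp add: N[symmetric] flip: ennreal_mult)
  finally show "(\<integral>\<^sup>+y. ennreal (gen_HR Z \<mu> \<Theta> y) \<partial>lborel) = 1" .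
qed

lemma gen_HR_marginal:
  fixes \<mu> :: "real^'n"
  assumes Z: "0 < Z" and Y: "distributed M lborel Y (\<lambda>y. ennreal (gen_HR Z \<mu> \<Theta> y))"
  shows "emeasure M {\<omega> \<in> space M. 1 < Y \<omega> $ k} = ennreal (1 / Z) *
    (\<integral>\<^sup>+x. ennreal (log_density (\<mu> - 1) \<Theta> x) * indicator (log_halfspace k) x \<partial>lborel)"
proof -
  let ?H = "{y::real^'n. 1 < y $ k}"
  have [measurable]: "?H \<in> sets borel" by measurable
  have "emeasure M {\<omega> \<in> space M. 1 < Y \<omega> $ k} = emeasure M (Y -` ?H \<inter> space M)"
    by (rule arg_cong[where f = "emeasure M"]) auto
  also have "\<dots> = (\<integral>\<^sup>+y. ennreal (gen_HR Z \<mu> \<Theta> y) * indicator ?H y \<partial>lborel)"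
    by (rule distributed_emeasure[OF Y]) simp
  also have "\<dots> = (\<integral>\<^sup>+y. ennreal (1 / Z) * (ennreal (gen_HR_exp \<mu> \<Theta> y) * indicator (pareto_domain \<inter> ?H) y) \<partial>lborel)"
    using Z by (intro nn_integral_cong)
      (auto simp: gen_HR_def indicator_def less_imp_le[OF gen_HR_exp_pos] simp flip: ennreal_mult)
  also have "\<dots> = ennreal (1 / Z) * (\<integral>\<^sup>+y. ennreal (gen_HR_exp \<mu> \<Theta> y) * indicator (pareto_domain \<inter> ?H) y \<partial>lborel)"
    by (rule nn_integral_cmult) measurable
  also have "(\<integral>\<^sup>+y. ennreal (gen_HR_exp \<mu> \<Theta> y) * indicator (pareto_domain \<inter> ?H) y \<partial>lborel) =
      (\<integral>\<^sup>+x. ennreal (log_density (\<mu> - 1) \<Theta> x) * indicator (log_halfspace k) x \<partial>lborel)"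
    by (rule nn_integral_gen_HR_exp) (auto simp: mem_pareto_domain ln_vec_def less_imp_le)
  finally show ?thesis .
qed

text \<open>The marginal probabilities are positive and finite, with ratios exp((u_k - u_j)/2). They
  agree exactly when \<open>u\<close> is constant, which characterises the Huesler--Reiss
  parameter.\<close>

lemma gen_HR_marginals_equal_iff:
  fixes \<mu> :: "real^'n"
  assumes Pos: "\<Theta> \<in> sym_kernel_one_pos" and \<mu>: "\<mu> \<bullet> 1 = real CARD('n) + 1" and Z: "0 < Z"
    and Y: "distributed M lborel Y (\<lambda>y. ennreal (gen_HR Z \<mu> \<Theta> y))"
  shows "(\<forall>j k. measure M {\<omega> \<in> space M. 1 < Y \<omega> $ j} = measure M {\<omega> \<in> space M. 1 < Y \<omega> $ k}) \<longleftrightarrow>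
    \<mu> = mu_HR \<Theta>"
proof -
  have \<nu>: "(\<mu> - 1) \<bullet> 1 = 1" using \<mu> by (simp add: inner_diff_left inner_one_one)
  let ?P = "\<lambda>k. \<integral>\<^sup>+x. ennreal (log_density (\<mu> - 1) \<Theta> x) * indicator (log_halfspace k) x \<partial>lborel"
  define u where "u = pinv \<Theta> *v (\<mu> - 1) - (1/2) *\<^sub>R diag_vec (pinv \<Theta>)"
  have pos: "0 < ?P k" for k
  proof (rule nn_integral_log_density_pos)
    have "0 < emeasure lborel (box 0 1 :: (real^'n) set)" by (rule emeasure_box_pos) simp
    also have "\<dots> \<le> emeasure lborel (log_halfspace k)"
      by (rule emeasure_mono) (auto simp: mem_box_cart)
    finally show "0 < emeasure lborel (log_halfspace k)" .
  qed simp
  have fin: "?P k < \<infinity>" for k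
  proof -
    have "?P k \<le> (\<integral>\<^sup>+x. ennreal (log_density (\<mu> - 1) \<Theta> x) * indicator log_domain x \<partial>lborel)"
      by (rule nn_integral_mono) (auto simp: indicator_def)
    also have "\<dots> < \<infinity>" using \<nu> by (intro log_density_integrable Pos) simp
    finally show ?thesis .
  qed
  have eq: "measure M {\<omega> \<in> space M. 1 < Y \<omega> $ j} = measure M {\<omega> \<in> space M. 1 < Y \<omega> $ k} \<longleftrightarrow> u $ j = u $ k"
    for j k
  proof -
    obtain p where p: "?P k = ennreal p" "p > 0"
      using pos[of k] fin[of k] by (cases "?P k") (auto simp: ennreal_less_zero_iff)
    have "measure M {\<omega> \<in> space M. 1 < Y \<omega> $ k} = 1 / Z * p"
      using Z p by (simp add: measure_def gen_HR_marginal[OF Z Y] flip: ennreal_mult)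
    moreover have "measure M {\<omega> \<in> space M. 1 < Y \<omega> $ j} = 1 / Z * (exp ((u $ k - u $ j) / 2) * p)"
      using Z p marginal_ratio[OF Pos \<nu>, of j k, folded u_def]
      by (simp add: measure_def gen_HR_marginal[OF Z Y] flip: ennreal_mult)
    ultimately show ?thesis using Z p by auto
  qed
  show ?thesis unfolding eq eq_mu_HR_iff[OF Pos \<mu>] u_def ..
qed

lemma gen_HR_husler_reiss:
  fixes \<Theta> :: "real^'n^'n"
  assumes Pos: "\<Theta> \<in> sym_kernel_one_pos" and Z: "normalizing_const (mu_HR \<Theta>) \<Theta> Z"
  shows "husler_reiss_density (gen_HR Z (mu_HR \<Theta>) \<Theta>)"
proof -
  have S: "\<Theta> \<in> sym_kernel_one" using Pos by (simp add: sym_kernel_one_pos_def)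
  let ?\<mu> = "mu_HR \<Theta>"
  let ?g = "gen_HR Z ?\<mu> \<Theta>"
  note one = mu_HR_inner_one[OF Pos]
  have int: "0 < Z" "(\<integral>\<^sup>+y. ennreal (?g y) \<partial>lborel) = 1"
    using gen_HR_integrable[OF Pos _ Z] one by auto
  define M where "M = density lborel (\<lambda>y. ennreal (?g y))"
  have Y: "distributed M lborel (\<lambda>x. x) (\<lambda>y. ennreal (?g y))"
    by (auto simp: distributed_def M_def intro!: distr_id2)
  have "prob_space M"
    by (rule prob_spaceI) (simp add: M_def emeasure_density int)
  \<comment> \<open>Homogeneity is demanded at every point of the domain, and the convention
    \<open>ln 0 = 0\<close> can break it where a coordinate vanishes. This version is zero there and
    differs from \<open>?g\<close> only on a null set.\<close>
  define f where "f y = (if \<forall>i. 0 < y $ i then ?g y else 0)" for y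
  have "distributed M lborel (\<lambda>x. x) (\<lambda>y. ennreal (f y))"
  proof -
    have [measurable]: "f \<in> borel_measurable borel" unfolding f_def[abs_def] by measurable
    have "AE y in lborel. f y = ?g y"
      using AE_nth_nonzero
      by eventually_elim (auto simp: f_def gen_HR_def mem_pareto_domain order_le_less)
    then have "density lborel (\<lambda>y. ennreal (?g y)) = density lborel (\<lambda>y. ennreal (f y))"
      by (intro density_cong) (auto elim: eventually_mono)
    then show ?thesis using Y by (simp add: distributed_def)
  qed
  moreover have "f (t *\<^sub>R y) = t powr (- (real CARD('n) + 1)) * f y"
    if "y \<in> pareto_domain" "t \<ge> 1" for y t
    using that pareto_domain_scaleR[OF that] gen_HR_exp_scaleR[OF S, of t y ?\<mu>]
    by (simp add: f_def gen_HR_def one zero_less_mult_iff)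
  moreover have "0 \<le> f y" for y
    using gen_HR_nonneg[OF int(1), of ?\<mu> \<Theta> y] by (simp add: f_def)
  moreover have "f y = 0" if "y \<notin> pareto_domain" for y
    using that by (simp add: f_def gen_HR_def)
  moreover have "\<forall>j k. measure M {\<omega> \<in> space M. 1 < \<omega> $ j} = measure M {\<omega> \<in> space M. 1 < \<omega> $ k}"
    using gen_HR_marginals_equal_iff[OF Pos one int(1) Y] by simp
  ultimately have MP: "multivariate_pareto M (\<lambda>x. x)"
    unfolding multivariate_pareto_def using \<open>prob_space M\<close>
    by (intro conjI exI[of _ f]) simp_all
  have nonneg: "\<forall>y. 0 \<le> ?g y" by (intro allI gen_HR_nonneg int(1))
  have "0 < 1 / Z" using int(1) by simp
  moreover have "AE y in lborel. y \<in> pareto_domain \<longrightarrow> ?g y = 1 / Z * gen_HR_exp ?\<mu> \<Theta> y"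
    by (simp add: gen_HR_def)
  ultimately have "husler_reiss M (\<lambda>x. x)"
    unfolding husler_reiss_def
    by (intro conjI MP bexI[OF _ Pos] exI[of _ ?g] exI[of _ "1 / Z"] nonneg Y)
  then show ?thesis
    unfolding husler_reiss_density_def using Y nonneg
    by (intro conjI exI[of _ M] exI[of _ "\<lambda>x. x"]) simp_all
qed

text \<open>The homogeneous version \<open>f\<close> agrees with the given function only almost
  everywhere. One point \<open>y\<close> with agreement at both \<open>y\<close> and
  \<open>2 *\<^sub>R y\<close> suffices: comparing the two scaling factors forces the homogeneity
  order, and then the equal marginals determine \<mu>.\<close>

lemma gen_HR_pareto_imp_mu_HR:
  fixes \<mu> :: "real^'n"
  assumes Pos: "\<Theta> \<in> sym_kernel_one_pos" and Z: "0 < Z"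
    and pareto: "multivariate_pareto_density (gen_HR Z \<mu> \<Theta>)"
  shows "\<mu> = mu_HR \<Theta>"
proof -
  have S: "\<Theta> \<in> sym_kernel_one" using Pos by (simp add: sym_kernel_one_pos_def)
  let ?g = "gen_HR Z \<mu> \<Theta>"
  obtain M :: "(real^'n) measure" and Y where MY: "multivariate_pareto M Y"
    and Y: "distributed M lborel Y (\<lambda>y. ennreal (?g y))"
    using pareto unfolding multivariate_pareto_density_def by (elim conjE exE)
  obtain f where f: "\<forall>y. 0 \<le> f y" "distributed M lborel Y (\<lambda>y. ennreal (f y))"
    "\<forall>y\<in>pareto_domain. \<forall>t\<ge>1. f (t *\<^sub>R y) = t powr (- (real CARD('n) + 1)) * f y"
    using MY unfolding multivariate_pareto_def by (elim conjE exE)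
  interpret prob_space M using MY by (simp add: multivariate_pareto_def)
  have [measurable]: "(\<lambda>y. ennreal (f y)) \<in> borel_measurable borel"
    using f(2) by (simp add: distributed_def)
  have AE1: "AE y in lborel. ennreal (f y) = ennreal (?g y)"
    by (rule distributed_unique[OF f(2) Y])
  then have AE2: "AE y in lborel. ennreal (f (2 *\<^sub>R y)) = ennreal (?g (2 *\<^sub>R y))"
    by (rule AE_lborel_scaleR) auto
  \<comment> \<open>A set of positive measure inside the domain with all coordinates positive, so
    the scaling law holds at each of its points.\<close>
  let ?U = "box (vec 2) (vec 3) :: (real^'n) set"
  have "0 < emeasure lborel ?U" by (rule emeasure_box_pos) simp
  then obtain y where y: "y \<in> ?U" "ennreal (f y) = ennreal (?g y)"
    "ennreal (f (2 *\<^sub>R y)) = ennreal (?g (2 *\<^sub>R y))"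
    using AE_imp_ex_mem[OF AE_conjI[OF AE1 AE2], of ?U] by auto
  have yi: "2 < y $ i" for i using y(1) by (simp add: mem_box_cart)
  have "0 < y $ i \<and> 1 < y $ i" for i using yi[of i] by simp
  then have dom: "y \<in> pareto_domain" and pos: "\<And>i. 0 < y $ i"
    by (auto simp: mem_pareto_domain less_imp_le)
  have fg: "f y = ?g y" "f (2 *\<^sub>R y) = ?g (2 *\<^sub>R y)"
    using y(2,3) unfolding ennreal_inj[OF f(1)[rule_format] gen_HR_nonneg[OF Z]] .
  have "2 powr (- (\<mu> \<bullet> 1)) * ?g y = ?g (2 *\<^sub>R y)"
    using pareto_domain_scaleR[OF dom, of 2] dom gen_HR_exp_scaleR[OF S, of 2 y \<mu>] pos
    by (simp add: gen_HR_def)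
  also have "\<dots> = 2 powr (- (real CARD('n) + 1)) * ?g y"
    using f(3) dom fg by simp
  finally have "2 powr (- (\<mu> \<bullet> 1)) = (2::real) powr (- (real CARD('n) + 1))"
    using Z dom gen_HR_exp_pos[of \<mu> \<Theta> y] by (simp add: gen_HR_def)
  then have \<mu>: "\<mu> \<bullet> 1 = real CARD('n) + 1" by (simp add: powr_inj)
  show ?thesis
    using MY gen_HR_marginals_equal_iff[OF Pos \<mu> Z Y] by (simp only: multivariate_pareto_def)
qed

theorem lemma2:
  fixes \<mu> :: "real ^ 'n" and \<Theta> :: "real ^ 'n ^ 'n" and Z :: real
  assumes "\<Theta> \<in> sym_kernel_one"
    and "normalizing_const \<mu> \<Theta> Z"
  shows "(\<Theta> \<in> sym_kernel_one_pos \<and> \<mu> = mu_HR \<Theta> \<longrightarrow>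
            husler_reiss_density (gen_HR Z \<mu> \<Theta>))
       \<and> (\<Theta> \<in> sym_kernel_one_pos \<and> \<mu> \<noteq> mu_HR \<Theta> \<and> \<mu> \<bullet> 1 > real CARD('n) \<longrightarrow>
            set_integrable lborel pareto_domain (gen_HR Z \<mu> \<Theta>) \<and>
            \<not> multivariate_pareto_density (gen_HR Z \<mu> \<Theta>))
       \<and> (\<Theta> \<notin> sym_kernel_one_pos \<or> \<mu> \<bullet> 1 \<le> real CARD('n) \<longrightarrow>
            \<not> set_integrable lborel pareto_domain (gen_HR Z \<mu> \<Theta>))"
proof (intro conjI impI)
  assume "\<Theta> \<in> sym_kernel_one_pos \<and> \<mu> = mu_HR \<Theta>"
  then show "husler_reiss_density (gen_HR Z \<mu> \<Theta>)" using gen_HR_husler_reiss assms(2) by blast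
next
  assume "\<Theta> \<in> sym_kernel_one_pos \<and> \<mu> \<noteq> mu_HR \<Theta> \<and> \<mu> \<bullet> 1 > real CARD('n)"
  then show "set_integrable lborel pareto_domain (gen_HR Z \<mu> \<Theta>)"
    and "\<not> multivariate_pareto_density (gen_HR Z \<mu> \<Theta>)"
    using gen_HR_integrable assms(2) gen_HR_pareto_imp_mu_HR by blast+
next
  assume "\<Theta> \<notin> sym_kernel_one_pos \<or> \<mu> \<bullet> 1 \<le> real CARD('n)"
  then show "\<not> set_integrable lborel pareto_domain (gen_HR Z \<mu> \<Theta>)"
    by (rule gen_HR_not_integrable[OF assms])
qed

end
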